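(* Let $d\ge 1$, let $\mathcal{O}\in O(d,\mathbb{R})$ be an orthogonal matrix, let $\mathcal{D}=\{0,a_1,\ldots,a_m\}\subset\mathbb{R}^d$ be any digit set with $\mathrm{Span}(\mathcal{D})=\mathbb{R}^d$ (so that $m\ge d$), and let $\boldsymbol{p}=(p_0,\ldots,p_m)$ be a probability vector with all $p_j>0$. Then there is a set $\mathcal{E}\subset(1,\infty)$ of Hausdorff dimension zero such that for all $\vartheta\in(1,\infty)\setminus\mathcal{E}$ the self-similar measure $\mu(\vartheta^{-1}\mathcal{O},\mathcal{D},\boldsymbol{p})$ belongs to $\mathscr{D}_d$, i.e. it has power Fourier decay.
   Context: For a contracting similitude $A=\vartheta^{-1}\mathcal{O}$ of $\mathbb{R}^d$ ($\vartheta>1$, $\mathcal{O}$ orthogonal), a digit set $\mathcal{D}=\{a_0=0,a_1,\ldots,a_m\}\subset\mathbb{R}^d$ and a probability vector $\boldsymbol{p}=(p_0,\ldots,p_m)$, $\mu(A,\mathcal{D},\boldsymbol{p})$ denotes the homogeneous self-similar measure: the unique Borel probability measure $\mu$ on $\mathbb{R}^d$ with $\mu=\sum_{j=0}^m p_j\,(\mu\circ f_j^{-1})$, where $f_j(x)=Ax+a_j$. Fourier transform: $\widehat{\mu}(\xi)=\int_{\mathbb{R}^d}e^{-2\pi i\langle\xi,x\rangle}\,d\mu(x)$. For $\gamma>0$, $\mathscr{D}_d(\gamma)$ is the set of finite positive Borel measures $\nu$ on $\mathbb{R}^d$ with $|\widehat{\nu}(\xi)|=O_\nu(|\xi|^{-\gamma})$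 as $|\xi|\to\infty$, and $\mathscr{D}_d=\bigcup_{\gamma>0}\mathscr{D}_d(\gamma)$. *)

theory Defs
  imports "HOL-Probability.Probability" "HOL-Library.Landau_Symbols"
begin

text \<open>
  The size \<open>(diam U)\<^sup>s\<close>, with the conventions that make the case \<open>s = 0\<close> the counting measure:
  the empty set has size 0 and a nonempty set has size 1 when \<open>s = 0\<close>
  (note that \<open>0 powr 0 = 0\<close>). The library's \<^const>\<open>diameter\<close> is meaningful only on bounded sets,
  hence the boundedness condition on covers below.
\<close>

definition hausdorff_gauge :: "real \<Rightarrow> 'a::metric_space set \<Rightarrow> ennreal" where
  "hausdorff_gauge s U =
     (if U = {} then 0 else if s = 0 then 1 else ennreal (diameter U powr s))"

definition hausdorff_premeasure :: "real \<Rightarrow> real \<Rightarrow> 'a::metric_space set \<Rightarrow> ennreal" where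
  "hausdorff_premeasure s \<delta> E =
     (INF U \<in> {U :: nat \<Rightarrow> 'a set. E \<subseteq> (\<Union>i. U i) \<and> (\<forall>i. bounded (U i) \<and> diameter (U i) \<le> \<delta>)}.
        \<Sum>i. hausdorff_gauge s (U i))"

definition hausdorff_measure :: "real \<Rightarrow> 'a::metric_space set \<Rightarrow> ennreal" where
  "hausdorff_measure s E = (SUP \<delta> \<in> {0<..}. hausdorff_premeasure s \<delta> E)"

definition hausdorff_dim :: "'a::metric_space set \<Rightarrow> ennreal" where
  "hausdorff_dim E = Inf (ennreal ` {s. 0 \<le> s \<and> hausdorff_measure s E = 0})"

definition ss_map :: "real^'n^'n \<Rightarrow> real^'n \<Rightarrow> real^'n \<Rightarrow> real^'n" where
  "ss_map A b x = A *v x + b"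

definition self_similar ::
    "real^'n^'n \<Rightarrow> nat \<Rightarrow> (nat \<Rightarrow> real^'n) \<Rightarrow> (nat \<Rightarrow> real) \<Rightarrow> (real^'n) measure \<Rightarrow> bool" where
  "self_similar A m a p \<mu> \<longleftrightarrow>
     prob_space \<mu> \<and> sets \<mu> = sets borel \<and>
     (\<forall>B \<in> sets borel. emeasure \<mu> B =
        (\<Sum>j\<le>m. ennreal (p j) * emeasure (distr \<mu> borel (ss_map A (a j))) B))"

text \<open>
  The digits are \<open>a 0, \<dots>, a m\<close> and the weights \<open>p 0, \<dots>, p m\<close>; values at larger indices are ignored.
  Existence and uniqueness hold whenever \<open>A\<close> is a contracting similitude and \<open>p\<close> a probability
  vector (Hutchinson).
\<close>

definition self_similar_measure ::
    "real^'n^'n \<Rightarrow> nat \<Rightarrow> (nat \<Rightarrow> real^'n) \<Rightarrow> (nat \<Rightarrow> real) \<Rightarrow> (real^'n) measure" where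
  "self_similar_measure A m a p = (THE \<mu>. self_similar A m a p \<mu>)"

definition fourier_measure :: "'a::euclidean_space measure \<Rightarrow> 'a \<Rightarrow> complex" where
  "fourier_measure \<nu> \<xi> = (LINT x|\<nu>. exp (- 2 * of_real pi * \<i> * of_real (\<xi> \<bullet> x)))"

definition power_decay_exp :: "real \<Rightarrow> 'a::euclidean_space measure set" where
  "power_decay_exp \<gamma> =
     {\<nu>. finite_measure \<nu> \<and> sets \<nu> = sets borel \<and>
          (\<lambda>\<xi>. norm (fourier_measure \<nu> \<xi>)) \<in> O[at_infinity](\<lambda>\<xi>. norm \<xi> powr (- \<gamma>))}"

definition power_decay :: "'a::euclidean_space measure set" where
  "power_decay = (\<Union>\<gamma>\<in>{0<..}. power_decay_exp \<gamma>)"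

end

theory Submission
  imports Defs
begin

text \<open>
  This is the Erdos--Kahane argument. With \<open>v\<^sub>k = \<theta>\<^sup>k \<O>\<^sup>k \<eta>\<close>, self-similarity bounds the Fourier transform
  at \<open>v\<^sub>N\<close> by a product over \<open>k \<le> N\<close> of factors that are at most some \<open>\<sigma> < 1\<close> whenever an inner product of \<open>v\<^sub>k\<close>
  with a digit is far from the integers. Hence power decay can only fail if, for every \<open>\<epsilon> > 0\<close> and infinitely
  many \<open>N\<close>, some \<open>\<eta>\<close> has fewer than \<open>\<epsilon> N\<close> such indices. Let \<open>K\<^sub>k\<close> be the vector of rounded
  inner products of \<open>v\<^sub>k\<close> with the digits. As the digits span, \<open>K\<^sub>k\<close> determines \<open>v\<^sub>k\<close> up to a bounded error,
  so \<open>K\<^sub>k, K\<^sub>k\<^sub>+\<^sub>1\<close> determine \<open>\<theta> = |v\<^sub>k\<^sub>+\<^sub>1| / |v\<^sub>k|\<close> up to \<open>O(\<theta>\<^sup>-\<^sup>k)\<close> and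
  \<open>v\<^sub>k\<^sub>+\<^sub>2 = \<theta> \<O> v\<^sub>k\<^sub>+\<^sub>1\<close> up to a bounded error. Thus \<open>K\<^sub>k\<^sub>+\<^sub>2\<close> has boundedly many possible values, and only
  one when the rounding errors are small. The exceptional parameters are therefore covered by
  \<open>exp (o(1) N)\<close> intervals of length \<open>O(b\<^sup>-\<^sup>N)\<close>, uniformly for \<open>\<theta> \<ge> b > 1\<close>.
\<close>

section \<open>Hausdorff premeasures\<close>

lemma hausdorff_premeasure_le:
  assumes "E \<subseteq> (\<Union>i. U i)" "\<And>i. bounded (U i)" "\<And>i. diameter (U i) \<le> \<delta>"
  shows "hausdorff_premeasure s \<delta> E \<le> (\<Sum>i. hausdorff_gauge s (U i))"
  unfolding hausdorff_premeasure_def using assms by (auto intro!: INF_lower)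

lemma hausdorff_premeasure_mono:
  assumes "E \<subseteq> F"
  shows "hausdorff_premeasure s \<delta> E \<le> hausdorff_premeasure s \<delta> F"
  unfolding hausdorff_premeasure_def by (rule INF_superset_mono) (use assms in auto)

text \<open>For fixed \<open>\<delta>\<close> the premeasure is already an outer measure:
  near-optimal covers of the \<open>E i\<close>, with errors \<open>e / 2 ^ (i + 1)\<close>, are
  interleaved into one sequence.\<close>

lemma hausdorff_premeasure_UN_le:
  "hausdorff_premeasure s \<delta> (\<Union>i::nat. E i) \<le> (\<Sum>i. hausdorff_premeasure s \<delta> (E i))"
proof (rule ennreal_le_epsilon)
  fix e :: real
  assume fin: "(\<Sum>i. hausdorff_premeasure s \<delta> (E i)) < top" and "0 < e"
  let ?h = "\<lambda>i. hausdorff_premeasure s \<delta> (E i)"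
  have "\<exists>U. E i \<subseteq> (\<Union>k. U k) \<and> (\<forall>k::nat. bounded (U k) \<and> diameter (U k) \<le> \<delta>) \<and>
          (\<Sum>k. hausdorff_gauge s (U k)) \<le> ?h i + ennreal (e * (1/2) ^ Suc i)" for i
  proof -
    have "?h i < top"
      using fin by (rule ennreal_suminf_lessD)
    then have "?h i < ?h i + ennreal (e * (1/2) ^ Suc i)"
      using \<open>0 < e\<close> ennreal_add_left_cancel_less[of "?h i" 0 "ennreal (e * (1/2) ^ Suc i)"]
      by (simp add: less_top)
    then obtain U where "E i \<subseteq> (\<Union>k. U k)" "\<forall>k::nat. bounded (U k) \<and> diameter (U k) \<le> \<delta>"
      "(\<Sum>k. hausdorff_gauge s (U k)) < ?h i + ennreal (e * (1/2) ^ Suc i)"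
      unfolding hausdorff_premeasure_def by (auto simp: INF_less_iff)
    then show ?thesis by (intro exI[of _ U]) (auto intro: less_imp_le)
  qed
  then obtain U where U: "\<And>i. E i \<subseteq> (\<Union>k::nat. U i k)" "\<And>i k. bounded (U i k)"
    "\<And>i k. diameter (U i k) \<le> \<delta>"
    "\<And>i. (\<Sum>k. hausdorff_gauge s (U i k)) \<le> ?h i + ennreal (e * (1/2) ^ Suc i)"
    by metis
  define V where "V n = U (fst (prod_decode n)) (snd (prod_decode n))" for n
  have "(\<Union>i. E i) \<subseteq> (\<Union>n. V n)"
  proof
    fix x assume "x \<in> (\<Union>i. E i)"
    then obtain i k where "x \<in> U i k" using U(1) by blast
    then have "x \<in> V (prod_encode (i, k))" by (simp add: V_def)
    then show "x \<in> (\<Union>n. V n)" by (rule UN_I[OF UNIV_I])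
  qed
  then have "hausdorff_premeasure s \<delta> (\<Union>i. E i) \<le> (\<Sum>n. hausdorff_gauge s (V n))"
    by (rule hausdorff_premeasure_le) (simp_all add: V_def U(2,3))
  also have "\<dots> = (\<Sum>n. (\<lambda>(i, k). hausdorff_gauge s (U i k)) (prod_decode n))"
    by (simp add: V_def case_prod_beta)
  also have "\<dots> = (\<Sum>i. \<Sum>k. hausdorff_gauge s (U i k))"
    by (rule suminf_ennreal_2dimen) simp
  also have "\<dots> \<le> (\<Sum>i. ?h i + ennreal (e * (1/2) ^ Suc i))"
    by (intro suminf_le U) auto
  also have "\<dots> = (\<Sum>i. ?h i) + (\<Sum>i. ennreal (e * (1/2) ^ Suc i))"
    by (rule suminf_add[symmetric]) auto
  also have "(\<Sum>i. ennreal (e * (1/2) ^ Suc i)) = ennreal e"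
    using \<open>0 < e\<close> sums_mult[OF power_half_series, of e]
    by (intro suminf_ennreal_eq) auto
  finally show "hausdorff_premeasure s \<delta> (\<Union>i. E i) \<le> (\<Sum>i. ?h i) + ennreal e" .
qed

text \<open>A cover has to be a sequence, so the finite family is padded with empty sets, whose
  gauge is 0.\<close>

lemma hausdorff_premeasure_finite_cover:
  assumes "finite X" "E \<subseteq> (\<Union>x\<in>X. V x)" "0 < s" "0 \<le> d" "d \<le> \<delta>"
    and V: "\<And>x. x \<in> X \<Longrightarrow> bounded (V x)" "\<And>x. x \<in> X \<Longrightarrow> diameter (V x) \<le> d"
  shows "hausdorff_premeasure s \<delta> E \<le> ennreal (real (card X) * d powr s)"
proof -
  obtain h where h: "bij_betw h {0..<card X} X"
    using ex_bij_betw_nat_finite[OF \<open>finite X\<close>] by blast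
  let ?U = "\<lambda>i. if i < card X then V (h i) else {}"
  have hX: "h i \<in> X" if "i < card X" for i
    using that h by (auto simp: bij_betw_def)
  have "E \<subseteq> (\<Union>i. ?U i)"
  proof
    fix x assume "x \<in> E"
    then obtain y where "y \<in> X" "x \<in> V y" using assms(2) by blast
    then obtain i where "i < card X" "h i = y" using h by (metis bij_betw_iff_bijections atLeastLessThan_iff)
    then show "x \<in> (\<Union>i. ?U i)" using \<open>x \<in> V y\<close> by (auto intro!: exI[of _ i])
  qed
  moreover have "bounded (?U i) \<and> diameter (?U i) \<le> d" for i
    using V[OF hX, of i] \<open>0 \<le> d\<close> by simp
  ultimately have "hausdorff_premeasure s \<delta> E \<le> (\<Sum>i. hausdorff_gauge s (?U i))"
    using \<open>d \<le> \<delta>\<close> by (intro hausdorff_premeasure_le) (blast intro: order_trans)+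
  also have "\<dots> = (\<Sum>i<card X. hausdorff_gauge s (?U i))"
    by (rule suminf_finite) (auto simp: hausdorff_gauge_def)
  also have "\<dots> \<le> (\<Sum>i<card X. ennreal (d powr s))"
  proof (rule sum_mono)
    fix i assume "i \<in> {..<card X}"
    then have "ennreal (diameter (V (h i)) powr s) \<le> ennreal (d powr s)"
      using V[OF hX] \<open>0 < s\<close> by (intro ennreal_leI powr_mono2 diameter_ge_0) simp_all
    then show "hausdorff_gauge s (?U i) \<le> ennreal (d powr s)"
      using \<open>0 < s\<close> by (simp add: hausdorff_gauge_def)
  qed
  also have "\<dots> = ennreal (real (card X) * d powr s)"
    by (simp add: ennreal_mult ennreal_of_nat_eq_real_of_nat)
  finally show ?thesis .
qed

text \<open>Borel-Cantelli: \<open>E\<close> lies in every tail union of the \<open>F N\<close>, and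
  by subadditivity a late tail costs at most a geometric remainder.\<close>

lemma hausdorff_premeasure_limsup_eq_0:
  assumes "\<And>x. x \<in> E \<Longrightarrow> frequently (\<lambda>N. x \<in> F N) sequentially"
    and ev: "eventually (\<lambda>N. hausdorff_premeasure s \<delta> (F N) \<le> ennreal (D * q ^ N)) sequentially"
    and "0 \<le> D" "0 \<le> q" "q < 1"
  shows "hausdorff_premeasure s \<delta> E = 0"
proof -
  obtain N1 where N1: "\<And>N. N \<ge> N1 \<Longrightarrow> hausdorff_premeasure s \<delta> (F N) \<le> ennreal (D * q ^ N)"
    using ev by (auto simp: eventually_sequentially)
  have bnd: "hausdorff_premeasure s \<delta> E \<le> ennreal (D * q ^ N0 / (1 - q))" if "N0 \<ge> N1" for N0
  proof -
    have "E \<subseteq> (\<Union>i. F (i + N0))"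
    proof
      fix x assume "x \<in> E"
      then obtain N where "N \<ge> N0" "x \<in> F N"
        using assms(1) by (meson frequently_sequentially)
      then have "x \<in> F ((N - N0) + N0)" by simp
      then show "x \<in> (\<Union>i. F (i + N0))" by blast
    qed
    then have "hausdorff_premeasure s \<delta> E \<le> hausdorff_premeasure s \<delta> (\<Union>i. F (i + N0))"
      by (rule hausdorff_premeasure_mono)
    also have "\<dots> \<le> (\<Sum>i. hausdorff_premeasure s \<delta> (F (i + N0)))"
      by (rule hausdorff_premeasure_UN_le)
    also have "\<dots> \<le> (\<Sum>i. ennreal (D * q ^ (i + N0)))"
      using that by (intro suminf_le N1) simp_all
    also have "(\<lambda>i. D * q ^ N0 * q ^ i) sums (D * q ^ N0 * (1 / (1 - q)))"
      using assms(4,5) by (intro sums_mult geometric_sums) simp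
    then have "(\<Sum>i. ennreal (D * q ^ (i + N0))) = ennreal (D * q ^ N0 / (1 - q))"
      using assms(3,4) by (intro suminf_ennreal_eq) (simp_all add: power_add mult_ac)
    finally show ?thesis .
  qed
  have "(\<lambda>N. D * q ^ N / (1 - q)) \<longlonglongrightarrow> D * 0 / (1 - q)"
    using assms(4,5) by (intro tendsto_intros LIMSEQ_power_zero) simp_all
  then have "(\<lambda>N. ennreal (D * q ^ N / (1 - q))) \<longlonglongrightarrow> ennreal 0"
    by (intro tendsto_ennrealI) simp
  then have "hausdorff_premeasure s \<delta> E \<le> ennreal 0"
    by (rule tendsto_lowerbound)
      (use bnd in \<open>blast intro: eventually_sequentiallyI\<close>, rule sequentially_bot)
  then show ?thesis by simp
qed

lemma hausdorff_dim_eq_0: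
  assumes "\<And>s. 0 < s \<Longrightarrow> hausdorff_measure s E = 0"
  shows "hausdorff_dim E = 0"
proof -
  have "hausdorff_dim E \<le> 0 + ennreal s" if "0 < s" for s
    unfolding hausdorff_dim_def add_0 by (intro Inf_lower imageI) (use assms that in simp)
  then have "hausdorff_dim E \<le> 0"
    by (rule ennreal_le_epsilon)
  then show ?thesis by simp
qed

section \<open>Existence, uniqueness and Fourier transform of self-similar measures\<close>

lemma ss_map_measurable: "ss_map A b \<in> borel_measurable borel"
  unfolding ss_map_def[abs_def]
  by (intro borel_measurable_continuous_onI continuous_intros linear_continuous_on) simp

definition digit_pmf :: "nat \<Rightarrow> (nat \<Rightarrow> real) \<Rightarrow> nat pmf" where
  "digit_pmf m p = embed_pmf (\<lambda>j. if j \<le> m then p j else 0)"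

locale weighted_digits =
  fixes m :: nat and p :: "nat \<Rightarrow> real"
  assumes p_nonneg: "j \<le> m \<Longrightarrow> 0 \<le> p j" and p_sum: "(\<Sum>j\<le>m. p j) = 1"
begin

lemma pmf_digit: "pmf (digit_pmf m p) j = (if j \<le> m then p j else 0)"
  unfolding digit_pmf_def
proof (rule pmf_embed_pmf)
  have "(\<integral>\<^sup>+x. ennreal (if x \<le> m then p x else 0) \<partial>count_space UNIV) =
      (\<Sum>x\<le>m. ennreal (if x \<le> m then p x else 0))"
    by (rule nn_integral_count_space') auto
  also have "\<dots> = (\<Sum>x\<le>m. ennreal (p x))" by (rule sum.cong) auto
  also have "\<dots> = 1" using p_nonneg p_sum by (subst sum_ennreal) auto
  finally show "(\<integral>\<^sup>+x. ennreal (if x \<le> m then p x else 0) \<partial>count_space UNIV) = 1" .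
qed (simp add: p_nonneg)

lemma set_digit_pmf: "set_pmf (digit_pmf m p) \<subseteq> {..m}"
  by (auto simp: set_pmf_eq pmf_digit)

lemma pair_map_measurable:
  assumes [measurable]: "X \<in> borel_measurable M"
  shows "(\<lambda>(j, x). ss_map A (a j) (X x)) \<in> borel_measurable (measure_pmf (digit_pmf m p) \<Otimes>\<^sub>M M)"
proof -
  have "(\<lambda>(j, x). ss_map A (a j) (X x)) \<in> borel_measurable (count_space UNIV \<Otimes>\<^sub>M M)"
    using measurable_compose[OF assms ss_map_measurable]
    by (intro measurable_pair_measure_countable1) auto
  then show ?thesis
    by (subst measurable_cong_sets[OF sets_pair_measure_cong[OF sets_measure_pmf_count_space refl] refl])
qed

text \<open>The right-hand side of the self-similarity equation is the law of the image under a
  randomly chosen map. A general \<open>X\<close> serves twice: as the identity for a given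
  self-similar measure, and as the random series in \<open>self_similar_exists\<close>.\<close>

lemma emeasure_distr_pair:
  fixes A :: "real^'n^'n"
  assumes "prob_space M" and X: "X \<in> borel_measurable M" and B: "B \<in> sets borel"
  shows "emeasure (distr (measure_pmf (digit_pmf m p) \<Otimes>\<^sub>M M) borel (\<lambda>(j, x). ss_map A (a j) (X x))) B =
    (\<Sum>j\<le>m. ennreal (p j) * emeasure (distr M borel (\<lambda>x. ss_map A (a j) (X x))) B)"
proof -
  interpret M: prob_space M by fact
  let ?P = "measure_pmf (digit_pmf m p)"
  let ?F = "\<lambda>(j, x). ss_map A (a j) (X x)"
  note F = pair_map_measurable[OF X, of A a]
  have "emeasure (distr (?P \<Otimes>\<^sub>M M) borel ?F) B = emeasure (?P \<Otimes>\<^sub>M M) (?F -` B \<inter> space (?P \<Otimes>\<^sub>M M))"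
    by (rule emeasure_distr[OF F B])
  also have "\<dots> = (\<integral>\<^sup>+j. emeasure M (Pair j -` (?F -` B \<inter> space (?P \<Otimes>\<^sub>M M))) \<partial>?P)"
    by (rule M.emeasure_pair_measure_alt[OF measurable_sets[OF F B]])
  also have "\<dots> = (\<integral>\<^sup>+j. emeasure (distr M borel (\<lambda>x. ss_map A (a j) (X x))) B \<partial>?P)"
  proof (rule nn_integral_cong)
    fix j
    have "Pair j -` (?F -` B \<inter> space (?P \<Otimes>\<^sub>M M)) = (\<lambda>x. ss_map A (a j) (X x)) -` B \<inter> space M"
      by (auto simp: space_pair_measure)
    then show "emeasure M (Pair j -` (?F -` B \<inter> space (?P \<Otimes>\<^sub>M M))) =
        emeasure (distr M borel (\<lambda>x. ss_map A (a j) (X x))) B"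
      using emeasure_distr[OF measurable_compose[OF X ss_map_measurable] B] by metis
  qed
  also have "\<dots> = (\<Sum>j\<le>m. emeasure (distr M borel (\<lambda>x. ss_map A (a j) (X x))) B * pmf (digit_pmf m p) j)"
    using set_digit_pmf by (intro nn_integral_measure_pmf_support) auto
  also have "\<dots> = (\<Sum>j\<le>m. ennreal (p j) * emeasure (distr M borel (\<lambda>x. ss_map A (a j) (X x))) B)"
    by (intro sum.cong refl) (simp add: pmf_digit mult.commute)
  finally show ?thesis .
qed

lemma self_similar_eq_distr:
  assumes ss: "self_similar A m a p \<mu>"
  shows "\<mu> = distr (measure_pmf (digit_pmf m p) \<Otimes>\<^sub>M \<mu>) borel (\<lambda>(j, x). ss_map A (a j) x)"
proof (rule measure_eqI)
  have [measurable_cong]: "sets \<mu> = sets borel" and "prob_space \<mu>" using ss by (auto simp: self_similar_def)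
  then show "sets \<mu> = sets (distr (measure_pmf (digit_pmf m p) \<Otimes>\<^sub>M \<mu>) borel (\<lambda>(j, x). ss_map A (a j) x))"
    by simp
  fix B assume "B \<in> sets \<mu>"
  then show "emeasure \<mu> B = emeasure (distr (measure_pmf (digit_pmf m p) \<Otimes>\<^sub>M \<mu>) borel (\<lambda>(j, x). ss_map A (a j) x)) B"
    using ss emeasure_distr_pair[OF \<open>prob_space \<mu>\<close>, of "\<lambda>x. x" B A a] \<open>sets \<mu> = sets borel\<close>
    by (simp add: self_similar_def)
qed

text \<open>Fubini for the digit and the point passes from sets to bounded functions. Banach-valued
  \<open>f\<close> covers both the real test functions of the uniqueness proof and the complex
  characters.\<close>

lemma integral_self_similar:
  fixes f :: "real^'n \<Rightarrow> 'b::{banach, second_countable_topology}"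
  assumes ss: "self_similar A m a p \<mu>"
    and f[measurable]: "f \<in> borel_measurable borel" and bound: "\<And>x. norm (f x) \<le> K"
  shows "(\<integral>x. f x \<partial>\<mu>) = (\<Sum>j\<le>m. p j *\<^sub>R (\<integral>x. f (ss_map A (a j) x) \<partial>\<mu>))"
proof -
  have sets[measurable_cong]: "sets \<mu> = sets borel" using ss by (auto simp: self_similar_def)
  interpret \<mu>: prob_space \<mu> using ss by (auto simp: self_similar_def)
  let ?P = "measure_pmf (digit_pmf m p)"
  interpret PM: pair_prob_space ?P \<mu> ..
  let ?F = "\<lambda>(j, x). ss_map A (a j) x"
  have F: "?F \<in> borel_measurable (?P \<Otimes>\<^sub>M \<mu>)"
    by (rule pair_map_measurable) simp
  have int: "integrable (?P \<Otimes>\<^sub>M \<mu>) (\<lambda>z. f (?F z))"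
    by (rule PM.P.integrable_const_bound[where B = K])
      (use bound measurable_compose[OF F f] in auto)
  have "(\<integral>x. f x \<partial>\<mu>) = (\<integral>x. f x \<partial>distr (?P \<Otimes>\<^sub>M \<mu>) borel ?F)"
    using self_similar_eq_distr[OF ss] by simp
  also have "\<dots> = (\<integral>z. f (?F z) \<partial>(?P \<Otimes>\<^sub>M \<mu>))"
    by (rule integral_distr[OF F f])
  also have "\<dots> = (\<integral>j. \<integral>x. f (?F (j, x)) \<partial>\<mu> \<partial>?P)"
    by (rule PM.integral_fst'[OF int, symmetric])
  also have "\<dots> = (\<Sum>j\<le>m. pmf (digit_pmf m p) j *\<^sub>R (\<integral>x. f (?F (j, x)) \<partial>\<mu>))"
    using set_digit_pmf by (intro integral_measure_pmf) auto
  also have "\<dots> = (\<Sum>j\<le>m. p j *\<^sub>R (\<integral>x. f (ss_map A (a j) x) \<partial>\<mu>))"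
    by (intro sum.cong refl) (simp add: pmf_digit)
  finally show ?thesis .
qed

section \<open>The transfer operator on bounded Lipschitz functions\<close>

definition transfer_op :: "real^'n^'n \<Rightarrow> (nat \<Rightarrow> real^'n) \<Rightarrow> (real^'n \<Rightarrow> real) \<Rightarrow> real^'n \<Rightarrow> real" where
  "transfer_op A a f x = (\<Sum>j\<le>m. p j * f (ss_map A (a j) x))"

lemma transfer_op_bound:
  assumes "\<And>x. \<bar>f x\<bar> \<le> K"
  shows "\<bar>transfer_op A a f x\<bar> \<le> K"
proof -
  have "\<bar>transfer_op A a f x\<bar> \<le> (\<Sum>j\<le>m. p j * K)"
    unfolding transfer_op_def using assms p_nonneg
    by (intro order_trans[OF sum_abs] sum_mono) (auto simp: abs_mult intro!: mult_left_mono)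
  also have "\<dots> = K" using p_sum by (simp flip: sum_distrib_right)
  finally show ?thesis .
qed

lemma transfer_op_Lipschitz:
  assumes A: "\<And>x. norm (A *v x) \<le> c * norm x" and "0 \<le> L" and L: "\<And>x y. \<bar>f x - f y\<bar> \<le> L * norm (x - y)"
  shows "\<bar>transfer_op A a f x - transfer_op A a f y\<bar> \<le> (L * c) * norm (x - y)"
proof -
  have "\<bar>f (ss_map A b x) - f (ss_map A b y)\<bar> \<le> L * c * norm (x - y)" for b
  proof -
    have "ss_map A b x - ss_map A b y = A *v (x - y)"
      by (simp add: ss_map_def matrix_vector_mult_diff_distrib)
    then have "\<bar>f (ss_map A b x) - f (ss_map A b y)\<bar> \<le> L * norm (A *v (x - y))" using L by metis
    also have "\<dots> \<le> L * (c * norm (x - y))" using A \<open>0 \<le> L\<close> by (rule mult_left_mono)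
    finally show ?thesis by simp
  qed
  then have "\<bar>\<Sum>j\<le>m. p j * (f (ss_map A (a j) x) - f (ss_map A (a j) y))\<bar> \<le> (\<Sum>j\<le>m. p j * (L * c * norm (x - y)))"
    using p_nonneg
    by (intro order_trans[OF sum_abs] sum_mono) (auto simp: abs_mult intro!: mult_left_mono)
  also have "\<dots> = L * c * norm (x - y)" using p_sum by (simp flip: sum_distrib_right)
  finally show ?thesis by (simp add: transfer_op_def right_diff_distrib sum_subtractf)
qed

lemma transfer_op_measurable:
  "f \<in> borel_measurable borel \<Longrightarrow> transfer_op A a f \<in> borel_measurable borel"
  unfolding transfer_op_def[abs_def]
  using measurable_compose[OF ss_map_measurable] by (intro borel_measurable_sum borel_measurable_times) auto

text \<open>The operator preserves the integral against \<open>\<mu>\<close> and shrinks the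
  Lipschitz constant by the factor \<open>c\<close>, so the iterates of \<open>f\<close> flatten to
  a constant that must be the integral. The left-hand side does not mention \<open>\<mu>\<close>,
  whence uniqueness.\<close>

lemma transfer_op_funpow_tendsto:
  fixes A :: "real^'n^'n"
  assumes ss: "self_similar A m a p \<mu>"
    and A: "\<And>x. norm (A *v x) \<le> c * norm x" and c: "0 \<le> c" "c < 1"
    and "0 \<le> L" and L: "\<And>x y. \<bar>f x - f y\<bar> \<le> L * norm (x - y)" and K: "\<And>x. \<bar>f x\<bar> \<le> K"
    and f: "f \<in> borel_measurable borel"
  shows "(\<lambda>n. (transfer_op A a ^^ n) f 0) \<longlonglongrightarrow> (\<integral>x. f x \<partial>\<mu>)"
proof -
  have sets[measurable_cong]: "sets \<mu> = sets borel" using ss by (auto simp: self_similar_def)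
  interpret \<mu>: prob_space \<mu> using ss by (auto simp: self_similar_def)
  define g where "g n = (transfer_op A a ^^ n) f" for n
  have g_Suc: "g (Suc n) = transfer_op A a (g n)" for n by (simp add: g_def)
  have gK: "\<bar>g n x\<bar> \<le> K" for n x
    by (induction n arbitrary: x) (auto simp: g_Suc intro: transfer_op_bound, simp add: g_def K)
  have gL: "\<bar>g n x - g n y\<bar> \<le> L * c ^ n * norm (x - y)" for n x y
  proof (induction n arbitrary: x y)
    case (Suc n)
    show ?case
      unfolding g_Suc power_Suc2 mult.assoc[symmetric]
      by (rule transfer_op_Lipschitz[OF A _ Suc.IH]) (simp add: \<open>0 \<le> L\<close> c)
  qed (use L in \<open>simp add: g_def\<close>)
  have gm[measurable]: "g n \<in> borel_measurable borel" for n
    by (induction n) (simp_all add: g_Suc transfer_op_measurable, simp add: g_def f)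
  have gi: "integrable \<mu> (\<lambda>x. g n (h x))" if [measurable]: "h \<in> borel_measurable borel" for n and h :: "real^'n \<Rightarrow> real^'n"
    by (rule \<mu>.integrable_const_bound[where B = K]) (auto simp: gK)
  have int: "(\<integral>x. g n x \<partial>\<mu>) = (\<integral>x. f x \<partial>\<mu>)" for n
  proof (induction n)
    case (Suc n)
    have "(\<integral>x. g (Suc n) x \<partial>\<mu>) = (\<Sum>j\<le>m. p j * (\<integral>x. g n (ss_map A (a j) x) \<partial>\<mu>))"
      unfolding g_Suc transfer_op_def
      by (subst Bochner_Integration.integral_sum) (auto intro!: integrable_mult_right gi ss_map_measurable)
    also have "\<dots> = (\<integral>x. g n x \<partial>\<mu>)"
      using integral_self_similar[OF ss gm, of n K] gK by simp
    finally show ?case using Suc by simp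
  qed (simp add: g_def)
  \<comment> \<open>The bound \<open>L * c ^ n * norm x\<close> gives pointwise convergence only; no
    moment of \<open>\<mu>\<close> is known, so the domination comes from the uniform bound
    \<open>K\<close>.\<close>
  have "(\<lambda>n. \<integral>x. g n x - g n 0 \<partial>\<mu>) \<longlonglongrightarrow> (\<integral>x. 0 \<partial>\<mu>)"
  proof (rule integral_dominated_convergence[where w = "\<lambda>_. 2 * K"])
    show "AE x in \<mu>. (\<lambda>n. g n x - g n 0) \<longlonglongrightarrow> 0"
    proof (rule AE_I2)
      fix x :: "real^'n"
      have "(\<lambda>n. L * c ^ n * norm x) \<longlonglongrightarrow> L * 0 * norm x"
        using c by (intro tendsto_intros LIMSEQ_power_zero) simp
      moreover have "norm (g n x - g n 0) \<le> L * c ^ n * norm x" for n using gL[of n x 0] by simp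
      ultimately show "(\<lambda>n. g n x - g n 0) \<longlonglongrightarrow> 0"
        by (intro Lim_null_comparison[of "\<lambda>n. g n x - g n 0" "\<lambda>n. L * c ^ n * norm x"]) auto
    qed
    show "AE x in \<mu>. norm (g n x - g n 0) \<le> 2 * K" for n
      using gK[of n] gK[of n 0] by (intro AE_I2) (smt (verit) real_norm_def)
  qed auto
  moreover have "(\<integral>x. g n x - g n 0 \<partial>\<mu>) = (\<integral>x. f x \<partial>\<mu>) - g n 0" for n
    using gi[of "\<lambda>x. x" n] by (simp add: int \<mu>.prob_space)
  ultimately have "(\<lambda>n. (\<integral>x. f x \<partial>\<mu>) - g n 0) \<longlonglongrightarrow> 0" by simp
  then have "(\<lambda>n. (\<integral>x. f x \<partial>\<mu>) - ((\<integral>x. f x \<partial>\<mu>) - g n 0)) \<longlonglongrightarrow> (\<integral>x. f x \<partial>\<mu>) - 0"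
    by (intro tendsto_intros)
  then show ?thesis by (simp add: g_def)
qed

end

text \<open>The indicator of a nonempty closed set is the limit of the functions
  \<open>max 0 (1 - k * infdist x S)\<close>, which are \<open>k\<close>-Lipschitz, and the closed
  sets form an intersection-stable generator.\<close>

lemma measure_eqI_Lipschitz:
  fixes \<mu> \<nu> :: "'a::euclidean_space measure"
  assumes "prob_space \<mu>" "prob_space \<nu>" and sets: "sets \<mu> = sets borel" "sets \<nu> = sets borel"
    and eq: "\<And>f L. 0 \<le> L \<Longrightarrow> (\<And>x y. \<bar>f x - f y\<bar> \<le> L * norm (x - y)) \<Longrightarrow> (\<And>x. \<bar>f x\<bar> \<le> (1::real)) \<Longrightarrow>
      f \<in> borel_measurable borel \<Longrightarrow> (\<integral>x. f x \<partial>\<mu>) = (\<integral>x. f x \<partial>\<nu>)"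
  shows "\<mu> = \<nu>"
proof (rule measure_eqI_generator_eq[where E = "Collect closed" and \<Omega> = UNIV and A = "\<lambda>_. UNIV"])
  interpret \<mu>: prob_space \<mu> by fact
  interpret \<nu>: prob_space \<nu> by fact
  show "Int_stable (Collect closed)" by (auto simp: Int_stable_def)
  show "sets \<mu> = sigma_sets UNIV (Collect closed)" "sets \<nu> = sigma_sets UNIV (Collect closed)"
    using sets by (simp_all add: borel_eq_closed)
  show "emeasure \<mu> UNIV \<noteq> \<infinity>" by simp
  fix S :: "'a set" assume "S \<in> Collect closed"
  then have S: "closed S" by simp
  show "emeasure \<mu> S = emeasure \<nu> S"
  proof (cases "S = {}")
    \<comment> \<open>\<open>infdist x {}\<close> is 0 by convention, which would make every
      \<open>f k\<close> equal to 1 for empty \<open>S\<close>.\<close>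
    case False
    define f :: "nat \<Rightarrow> 'a \<Rightarrow> real" where "f k x = max 0 (1 - real k * infdist x S)" for k x
    have fL: "\<bar>f k x - f k y\<bar> \<le> real k * norm (x - y)" for k x y
    proof -
      have "\<bar>f k x - f k y\<bar> \<le> \<bar>real k * infdist x S - real k * infdist y S\<bar>" by (auto simp: f_def)
      also have "\<dots> = real k * \<bar>infdist x S - infdist y S\<bar>"
        by (simp add: abs_mult flip: right_diff_distrib)
      also have "\<dots> \<le> real k * norm (x - y)"
        using infdist_triangle_abs[of x S y] by (intro mult_left_mono) (auto simp: dist_norm)
      finally show ?thesis .
    qed
    have f1: "\<bar>f k x\<bar> \<le> 1" for k x using infdist_nonneg[of x S] by (simp add: f_def)
    have fm: "f k \<in> borel_measurable borel" for k
      unfolding f_def[abs_def] by (intro borel_measurable_continuous_onI continuous_intros)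
    have lim: "(\<lambda>k. f k x) \<longlonglongrightarrow> indicator S x" for x
    proof (cases "x \<in> S")
      case False
      then have "infdist x S > 0"
        using S \<open>S \<noteq> {}\<close> infdist_nonneg[of x S] in_closed_iff_infdist_zero[of S x] by force
      then obtain k0 :: nat where k0: "1 < real k0 * infdist x S" using reals_Archimedean3 by blast
      have "f k x = 0" if "k \<ge> k0" for k
      proof -
        have "real k0 * infdist x S \<le> real k * infdist x S"
          using that infdist_nonneg by (intro mult_right_mono) auto
        then show ?thesis using k0 by (simp add: f_def)
      qed
      then have "eventually (\<lambda>k. f k x = 0) sequentially" by (auto simp: eventually_sequentially)
      then show ?thesis using False by (simp add: tendsto_eventually)
    qed (simp add: f_def)
    have to: "(\<lambda>k. \<integral>x. f k x \<partial>N) \<longlonglongrightarrow> measure N S" if "prob_space N" "sets N = sets borel" for N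
    proof -
      interpret N: prob_space N by fact
      have [measurable_cong]: "sets N = sets borel" by fact
      have "space N = UNIV" using sets_eq_imp_space_eq[OF that(2)] by simp
      have "(\<lambda>k. \<integral>x. f k x \<partial>N) \<longlonglongrightarrow> (\<integral>x. indicator S x \<partial>N)"
        by (rule integral_dominated_convergence[where w = "\<lambda>_. 1"])
          (use fm f1 lim S in \<open>auto simp: \<open>sets N = sets borel\<close> cong: measurable_cong_sets\<close>)
      then show ?thesis using S that(2) \<open>space N = UNIV\<close> by (simp add: borel_closed)
    qed
    have "(\<integral>x. f k x \<partial>\<mu>) = (\<integral>x. f k x \<partial>\<nu>)" for k
      by (rule eq[of "real k"]) (use fL f1 fm in auto)
    then have "measure \<mu> S = measure \<nu> S"
      using to[OF assms(1) sets(1)] to[OF assms(2) sets(2)] by (simp add: LIMSEQ_unique)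
    then show ?thesis by (simp add: \<mu>.emeasure_eq_measure \<nu>.emeasure_eq_measure)
  qed simp
qed auto

section \<open>Uniqueness and existence of the self-similar measure\<close>

context weighted_digits
begin

lemma self_similar_unique:
  fixes A :: "real^'n^'n"
  assumes A: "\<And>x. norm (A *v x) \<le> c * norm x" and c: "0 \<le> c" "c < 1"
    and ss: "self_similar A m a p \<mu>" "self_similar A m a p \<nu>"
  shows "\<mu> = \<nu>"
proof (rule measure_eqI_Lipschitz)
  show "prob_space \<mu>" "prob_space \<nu>" "sets \<mu> = sets borel" "sets \<nu> = sets borel"
    using ss by (auto simp: self_similar_def)
  fix f :: "real^'n \<Rightarrow> real" and L :: real
  assume f: "0 \<le> L" "\<And>x y. \<bar>f x - f y\<bar> \<le> L * norm (x - y)" "\<And>x. \<bar>f x\<bar> \<le> 1" "f \<in> borel_measurable borel"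
  show "(\<integral>x. f x \<partial>\<mu>) = (\<integral>x. f x \<partial>\<nu>)"
    using transfer_op_funpow_tendsto[OF ss(1) A c f] transfer_op_funpow_tendsto[OF ss(2) A c f]
    by (rule LIMSEQ_unique)
qed

text \<open>The measure is the law of the series \<open>X\<close> with independent digits.
  Prepending one more independent digit leaves the law of the digit sequence unchanged and acts on
  \<open>X\<close> as \<open>ss_map\<close>.\<close>

lemma self_similar_exists:
  fixes A :: "real^'n^'n" and a :: "nat \<Rightarrow> real^'n"
  assumes A: "\<And>x. norm (A *v x) \<le> c * norm x" and c: "0 \<le> c" "c < 1"
  shows "\<exists>\<mu>. self_similar A m a p \<mu>"
proof -
  let ?P = "measure_pmf (digit_pmf m p)"
  interpret S: sequence_space ?P by unfold_locales
  \<comment> \<open>indices are clamped so that the series converges for every \<open>\<omega>\<close>, not only almost surely\<close>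
  define d where "d j = a (min j m)" for j
  define R where "R = Max ((\<lambda>j. norm (a j)) ` {..m})"
  have R: "norm (d j) \<le> R" for j unfolding R_def d_def by (intro Max_ge) auto
  define X where "X \<omega> = (\<Sum>i. ((*v) A ^^ i) (d (\<omega> i)))" for \<omega> :: "nat \<Rightarrow> nat"
  have pow: "norm (((*v) A ^^ i) x) \<le> c ^ i * norm x" for i x
  proof (induction i)
    case (Suc i)
    have "norm (((*v) A ^^ Suc i) x) \<le> c * norm (((*v) A ^^ i) x)" using A by simp
    also have "\<dots> \<le> c * (c ^ i * norm x)" using Suc c by (intro mult_left_mono) auto
    finally show ?case by simp
  qed simp
  have summ: "summable (\<lambda>i. ((*v) A ^^ i) (d (\<omega> i)))" for \<omega> :: "nat \<Rightarrow> nat"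
  proof (rule summable_comparison_test)
    show "summable (\<lambda>i. c ^ i * R)" using c by (intro summable_mult2 summable_geometric) simp
    show "\<exists>N. \<forall>i\<ge>N. norm (((*v) A ^^ i) (d (\<omega> i))) \<le> c ^ i * R"
      using pow R c by (meson mult_left_mono order_trans zero_le_power)
  qed
  have X_shift: "X (case_nat j \<omega>) = ss_map A (d j) (X \<omega>)" for j \<omega>
  proof -
    have "X (case_nat j \<omega>) = (\<Sum>i. ((*v) A ^^ Suc i) (d (\<omega> i))) + d j"
      unfolding X_def using suminf_split_head[OF summ[of "case_nat j \<omega>"]] by simp
    also have "(\<Sum>i. ((*v) A ^^ Suc i) (d (\<omega> i))) = A *v X \<omega>"
      unfolding X_def using bounded_linear.suminf[OF matrix_vector_mul_bounded_linear summ, of A \<omega>] by simp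
    finally show ?thesis by (simp add: ss_map_def)
  qed
  have X[measurable]: "X \<in> borel_measurable S.S"
    unfolding X_def[abs_def]
  proof (rule borel_measurable_suminf)
    fix i
    have "(\<lambda>\<omega>. \<omega> i) \<in> measurable S.S ?P" by (rule measurable_component_singleton) simp
    moreover have "(\<lambda>j. ((*v) A ^^ i) (d j)) \<in> borel_measurable ?P" by simp
    ultimately show "(\<lambda>\<omega>. ((*v) A ^^ i) (d (\<omega> i))) \<in> borel_measurable S.S" by (rule measurable_compose)
  qed
  have cn: "(\<lambda>(s, \<omega>). case_nat s \<omega>) \<in> measurable (?P \<Otimes>\<^sub>M S.S) S.S" by measurable
  have "self_similar A m a p (distr S.S borel X)"
    unfolding self_similar_def
  proof (intro conjI ballI)
    show "prob_space (distr S.S borel X)" by (rule S.P.prob_space_distr[OF X])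
    fix B :: "(real^'n) set" assume B: "B \<in> sets borel"
    have "distr S.S borel X = distr (distr (?P \<Otimes>\<^sub>M S.S) S.S (\<lambda>(s, \<omega>). case_nat s \<omega>)) borel X"
      by (simp only: S.PiM_iter)
    also have "\<dots> = distr (?P \<Otimes>\<^sub>M S.S) borel (X \<circ> (\<lambda>(s, \<omega>). case_nat s \<omega>))"
      by (rule distr_distr[OF X cn])
    also have "X \<circ> (\<lambda>(s, \<omega>). case_nat s \<omega>) = (\<lambda>(j, \<omega>). ss_map A (d j) (X \<omega>))"
      by (auto simp: X_shift)
    finally have "emeasure (distr S.S borel X) B =
        (\<Sum>j\<le>m. ennreal (p j) * emeasure (distr S.S borel (\<lambda>\<omega>. ss_map A (d j) (X \<omega>))) B)"
      using emeasure_distr_pair[OF S.P.prob_space_axioms X B, of A d] by simp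
    also have "\<dots> = (\<Sum>j\<le>m. ennreal (p j) * emeasure (distr (distr S.S borel X) borel (ss_map A (a j))) B)"
      by (intro sum.cong refl) (simp add: distr_distr[OF ss_map_measurable X] comp_def d_def min_absorb1)
    finally show "emeasure (distr S.S borel X) B =
        (\<Sum>j\<le>m. ennreal (p j) * emeasure (distr (distr S.S borel X) borel (ss_map A (a j))) B)" .
  qed simp
  then show ?thesis ..
qed

lemma self_similar_measure:
  fixes A :: "real^'n^'n"
  assumes A: "\<And>x. norm (A *v x) \<le> c * norm x" and c: "0 \<le> c" "c < 1"
  shows "self_similar A m a p (self_similar_measure A m a p)"
  unfolding self_similar_measure_def
  using self_similar_exists[OF A c] self_similar_unique[OF A c] by (metis theI)

end

section \<open>Fourier transform of a self-similar measure\<close>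

definition character :: "'a::real_inner \<Rightarrow> 'a \<Rightarrow> complex" where
  "character \<xi> x = exp (- 2 * of_real pi * \<i> * of_real (\<xi> \<bullet> x))"

lemma character_eq_cis: "character \<xi> x = cis (- (2 * pi * (\<xi> \<bullet> x)))"
  by (simp add: character_def cis_conv_exp mult_ac)

lemma norm_character [simp]: "norm (character \<xi> x) = 1"
  by (simp add: character_eq_cis)

lemma character_measurable: "character (\<xi>::'a::euclidean_space) \<in> borel_measurable borel"
  unfolding character_def[abs_def] by (intro borel_measurable_continuous_onI continuous_intros)

text \<open>This is the Fourier transform of the sum of the point masses \<open>p j\<close> at
  \<open>a j\<close>.\<close>

definition digit_poly :: "nat \<Rightarrow> (nat \<Rightarrow> 'a::real_inner) \<Rightarrow> (nat \<Rightarrow> real) \<Rightarrow> 'a \<Rightarrow> complex" where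
  "digit_poly m a p \<xi> = (\<Sum>j\<le>m. p j *\<^sub>R character \<xi> (a j))"

lemma norm_fourier_measure_le_1:
  assumes "prob_space \<mu>"
  shows "norm (fourier_measure \<mu> \<xi>) \<le> 1"
proof -
  interpret prob_space \<mu> by fact
  have "norm (fourier_measure \<mu> \<xi>) \<le> (\<integral>x. norm (character \<xi> x) \<partial>\<mu>)"
    unfolding fourier_measure_def character_def by (rule integral_norm_bound)
  then show ?thesis by (simp add: prob_space)
qed

text \<open>A self-similar measure is the convolution of the digit distribution with its own image
  under \<open>A\<close>, hence the product; \<open>\<xi> v* A\<close> is the transpose of
  \<open>A\<close> applied to \<open>\<xi>\<close>.\<close>

lemma (in weighted_digits) fourier_self_similar:
  fixes A :: "real^'n^'n"
  assumes "self_similar A m a p \<mu>"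
  shows "fourier_measure \<mu> \<xi> = digit_poly m a p \<xi> * fourier_measure \<mu> (\<xi> v* A)"
proof -
  have "character \<xi> (ss_map A b x) = character \<xi> b * character (\<xi> v* A) x" for b x
    by (simp add: character_eq_cis ss_map_def inner_add_right dot_lmul_matrix cis_mult algebra_simps)
  then have "(\<integral>x. character \<xi> x \<partial>\<mu>) = (\<Sum>j\<le>m. p j *\<^sub>R (character \<xi> (a j) * (\<integral>x. character (\<xi> v* A) x \<partial>\<mu>)))"
    using integral_self_similar[OF assms character_measurable, of \<xi> 1] by simp
  moreover have "fourier_measure \<mu> \<xi> = (\<integral>x. character \<xi> x \<partial>\<mu>)" for \<xi>
    by (simp only: fourier_measure_def character_def)
  ultimately show ?thesis by (simp add: digit_poly_def sum_distrib_right)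
qed

lemma (in weighted_digits) norm_digit_poly_le_1: "norm (digit_poly m a p \<xi>) \<le> 1"
proof -
  have "norm (digit_poly m a p \<xi>) \<le> (\<Sum>j\<le>m. p j)"
    unfolding digit_poly_def using p_nonneg by (intro order_trans[OF norm_sum] sum_mono) simp
  then show ?thesis by (simp add: p_sum)
qed

section \<open>Counting rounded orbits\<close>

lemma card_le_mult_fibres:
  assumes "finite X" "Y \<subseteq> (\<Union>x\<in>X. F x)" "\<And>x. x \<in> X \<Longrightarrow> finite (F x) \<and> card (F x) \<le> B"
  shows "finite Y \<and> card Y \<le> card X * B"
proof -
  have fin: "finite (\<Union>x\<in>X. F x)" using assms by blast
  have "card Y \<le> card (\<Union>x\<in>X. F x)" using fin assms(2) by (rule card_mono)
  also have "\<dots> \<le> (\<Sum>x\<in>X. card (F x))" using assms(1) by (rule card_UN_le)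
  also have "\<dots> \<le> (\<Sum>x\<in>X. B)" using assms(3) by (intro sum_mono) auto
  finally show ?thesis using fin assms(2) finite_subset by auto
qed

text \<open>Quantitative form of the spanning hypothesis: the vectors \<open>y\<close> for which
  some \<open>C\<close> works, uniformly in \<open>x\<close> and \<open>e\<close>, form a subspace
  containing the digits. So it contains the basis vectors, and these control the norm.\<close>

lemma norm_le_of_inner_le:
  fixes a :: "nat \<Rightarrow> 'a::euclidean_space"
  assumes "span (a ` {..m}) = UNIV"
  obtains C where "0 < C" "\<And>x e. (\<And>j. j \<le> m \<Longrightarrow> \<bar>x \<bullet> a j\<bar> \<le> e) \<Longrightarrow> norm x \<le> C * e"
proof -
  let ?S = "{y. \<exists>C\<ge>0. \<forall>x e. (\<forall>j\<le>m. \<bar>x \<bullet> a j\<bar> \<le> e) \<longrightarrow> \<bar>x \<bullet> y\<bar> \<le> C * e}"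
  have "subspace ?S"
  proof (rule subspaceI)
    show "0 \<in> ?S" by (auto intro!: exI[of _ 0])
  next
    fix y z assume "y \<in> ?S" "z \<in> ?S"
    then obtain C D where "C \<ge> 0" "D \<ge> 0"
      and C: "\<And>x e. (\<forall>j\<le>m. \<bar>x \<bullet> a j\<bar> \<le> e) \<Longrightarrow> \<bar>x \<bullet> y\<bar> \<le> C * e"
      and D: "\<And>x e. (\<forall>j\<le>m. \<bar>x \<bullet> a j\<bar> \<le> e) \<Longrightarrow> \<bar>x \<bullet> z\<bar> \<le> D * e"
      by auto
    have "\<bar>x \<bullet> (y + z)\<bar> \<le> (C + D) * e" if "\<forall>j\<le>m. \<bar>x \<bullet> a j\<bar> \<le> e" for x e
      using C[OF that] D[OF that] by (simp add: inner_add_right distrib_right)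
    then show "y + z \<in> ?S" using \<open>C \<ge> 0\<close> \<open>D \<ge> 0\<close> by (auto intro!: exI[of _ "C + D"])
  next
    fix c y assume "y \<in> ?S"
    then obtain C where "C \<ge> 0"
      and C: "\<And>x e. (\<forall>j\<le>m. \<bar>x \<bullet> a j\<bar> \<le> e) \<Longrightarrow> \<bar>x \<bullet> y\<bar> \<le> C * e"
      by auto
    have "\<bar>x \<bullet> (c *\<^sub>R y)\<bar> \<le> (\<bar>c\<bar> * C) * e" if "\<forall>j\<le>m. \<bar>x \<bullet> a j\<bar> \<le> e" for x e
      using mult_left_mono[OF C[OF that], of "\<bar>c\<bar>"] by (simp add: abs_mult mult.assoc)
    then show "c *\<^sub>R y \<in> ?S" using \<open>C \<ge> 0\<close> by (auto intro!: exI[of _ "\<bar>c\<bar> * C"])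
  qed
  moreover have "a ` {..m} \<subseteq> ?S" by (auto intro!: exI[of _ 1])
  ultimately have "span (a ` {..m}) \<subseteq> ?S" by (rule span_minimal[rotated])
  then have "\<forall>y. \<exists>C\<ge>0. \<forall>x e. (\<forall>j\<le>m. \<bar>x \<bullet> a j\<bar> \<le> e) \<longrightarrow> \<bar>x \<bullet> y\<bar> \<le> C * e"
    unfolding assms by blast
  then obtain C where C0: "\<And>y. C y \<ge> 0"
    and C: "\<And>y x e. (\<forall>j\<le>m. \<bar>x \<bullet> a j\<bar> \<le> e) \<Longrightarrow> \<bar>x \<bullet> y\<bar> \<le> C y * e"
    by metis
  show ?thesis
  proof
    show "0 < (\<Sum>b\<in>Basis. C b) + 1" using C0 by (simp add: sum_nonneg add_nonneg_pos)
    fix x :: 'a and e assume *: "\<And>j. j \<le> m \<Longrightarrow> \<bar>x \<bullet> a j\<bar> \<le> e"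
    then have "0 \<le> e" by (meson abs_ge_zero order_trans le0)
    have "norm x \<le> (\<Sum>b\<in>Basis. \<bar>x \<bullet> b\<bar>)" by (rule norm_le_l1)
    also have "\<dots> \<le> (\<Sum>b\<in>Basis. C b * e)" using C * by (intro sum_mono) blast
    also have "\<dots> \<le> ((\<Sum>b\<in>Basis. C b) + 1) * e"
      using \<open>0 \<le> e\<close> by (simp add: sum_distrib_right distrib_right)
    finally show "norm x \<le> ((\<Sum>b\<in>Basis. C b) + 1) * e" .
  qed
qed

lemma card_le_1_if_all_eq:
  assumes "\<And>x y. x \<in> S \<Longrightarrow> y \<in> S \<Longrightarrow> x = y"
  shows "finite S \<and> card S \<le> 1"
proof -
  have "S = {} \<or> (\<exists>x. S = {x})" using assms by blast
  then show ?thesis by auto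
qed

text \<open>Integer vectors of length \<open>m + 1\<close> are encoded as functions vanishing beyond
  \<open>m\<close>, so that boxes are finite and equal vectors are equal functions;
  \<open>rounding\<close> follows the same convention.\<close>

definition int_box :: "nat \<Rightarrow> real \<Rightarrow> (nat \<Rightarrow> int) set" where
  "int_box m c = {z. (\<forall>j\<le>m. \<bar>real_of_int (z j)\<bar> \<le> c) \<and> (\<forall>j>m. z j = 0)}"

lemma finite_int_box: "finite (int_box m c)"
proof -
  have "finite {z::nat \<Rightarrow> int. \<forall>j. (j \<in> {..m} \<longrightarrow> z j \<in> {-\<lceil>c\<rceil>..\<lceil>c\<rceil>}) \<and> (j \<notin> {..m} \<longrightarrow> z j = 0)}"
    by (rule finite_set_of_finite_funs) auto
  moreover have "z \<in> {-\<lceil>c\<rceil>..\<lceil>c\<rceil>}" if "\<bar>real_of_int z\<bar> \<le> c" for z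
    using that by (auto simp: abs_le_iff) linarith+
  then have "int_box m c \<subseteq> {z. \<forall>j. (j \<in> {..m} \<longrightarrow> z j \<in> {-\<lceil>c\<rceil>..\<lceil>c\<rceil>}) \<and> (j \<notin> {..m} \<longrightarrow> z j = 0)}"
    by (force simp: int_box_def)
  ultimately show ?thesis by (rule finite_subset[rotated])
qed

lemma card_le_int_box:
  assumes "\<And>z w. z \<in> Z \<Longrightarrow> w \<in> Z \<Longrightarrow> (\<lambda>j. z j - w j) \<in> int_box m c"
  shows "finite Z \<and> card Z \<le> card (int_box m c)"
proof (cases "Z = {}")
  case False
  then obtain w where w: "w \<in> Z" by blast
  have inj: "inj_on (\<lambda>z j. z j - w j) Z" by (auto simp: inj_on_def fun_eq_iff)
  have sub: "(\<lambda>z j. z j - w j) ` Z \<subseteq> int_box m c" using assms w by auto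
  show ?thesis
    using inj_on_finite[OF inj sub finite_int_box] card_inj_on_le[OF inj sub finite_int_box] by blast
qed auto

definition rounding :: "(nat \<Rightarrow> 'a::real_inner) \<Rightarrow> nat \<Rightarrow> 'a \<Rightarrow> nat \<Rightarrow> int" where
  "rounding a m x = (\<lambda>j. if j \<le> m then round (x \<bullet> a j) else 0)"

definition near_lattice :: "(nat \<Rightarrow> 'a::real_inner) \<Rightarrow> nat \<Rightarrow> real \<Rightarrow> 'a \<Rightarrow> bool" where
  "near_lattice a m \<rho> x \<longleftrightarrow> (\<forall>j\<le>m. \<bar>x \<bullet> a j - of_int (round (x \<bullet> a j))\<bar> \<le> \<rho>)"

text \<open>Estimates with a general error \<open>e\<close> can thus be used with
  \<open>e = \<rho>\<close> at good steps and with \<open>e = 1/2\<close> at all others.\<close>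

lemma near_lattice_half: "near_lattice a m (1/2) x"
  unfolding near_lattice_def using of_int_round_abs_le by (metis abs_minus_commute)

section \<open>Orbits and the continuation of their codes\<close>

locale expanding_orbits =
  fixes f :: "'a::euclidean_space \<Rightarrow> 'a" and a :: "nat \<Rightarrow> 'a" and m :: nat and b b' C R :: real
  assumes lin: "linear f" and iso: "\<And>x. norm (f x) = norm x"
    and b: "1 < b" "b \<le> b'" and C: "0 < C" and R: "0 < R"
    and lower: "\<And>x e. (\<And>j. j \<le> m \<Longrightarrow> \<bar>x \<bullet> a j\<bar> \<le> e) \<Longrightarrow> norm x \<le> C * e"
    and upper: "\<And>j. j \<le> m \<Longrightarrow> norm (a j) \<le> R"
begin

definition orbit :: "real \<Rightarrow> 'a \<Rightarrow> nat \<Rightarrow> 'a" where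
  "orbit \<theta> \<eta> k = \<theta> ^ k *\<^sub>R (f ^^ k) \<eta>"

abbreviation "code \<theta> \<eta> k \<equiv> rounding a m (orbit \<theta> \<eta> k)"

text \<open>The compact range of \<open>\<theta>\<close> makes all constants uniform. By
  \<open>obtain_orbit\<close> every vector of norm at least 1 lies on an orbit that starts in the
  annulus \<open>1 \<le> norm \<eta> \<le> \<theta>\<close>, and
  \<open>\<theta> \<le> b'\<close>.\<close>

definition params :: "(real \<times> 'a) set" where
  "params = {b..b'} \<times> {\<eta>. 1 \<le> norm \<eta> \<and> norm \<eta> \<le> b'}"

text \<open>If two orbits have errors at most \<open>e\<close> and equal codes at \<open>k\<close>
  and \<open>k + 1\<close>, their inner products with a digit at \<open>k + 2\<close> differ by at
  most \<open>H * e\<close>; see \<open>code_step\<close>.\<close>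

definition H :: real where "H = R * (2 * C * b' * (2 + b'))"

text \<open>By \<open>code_step\<close> below, errors at most \<open>\<rho>\<close> leave an integer of absolute value below 1.\<close>

definition \<rho> :: real where "\<rho> = 1 / (H + 3)"

text \<open>Three indices enter: the errors at \<open>k\<close> and \<open>k + 1\<close> govern the
  prediction of the next code, the one at \<open>k + 2\<close> decides whether the prediction is
  exact.\<close>

definition good_step :: "real \<Rightarrow> 'a \<Rightarrow> nat \<Rightarrow> bool" where
  "good_step \<theta> \<eta> k \<longleftrightarrow> (\<forall>i\<in>{k, k+1, k+2}. near_lattice a m \<rho> (orbit \<theta> \<eta> i))"

definition bad_count :: "real \<Rightarrow> 'a \<Rightarrow> nat \<Rightarrow> nat" where
  "bad_count \<theta> \<eta> n = card {k. k < n \<and> \<not> good_step \<theta> \<eta> k}"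

text \<open>Two consecutive codes are kept because the ratio of the norms of the encoded vectors is
  what locates \<open>\<theta>\<close>. The bound on \<open>bad_count\<close> at \<open>n\<close>
  concerns orbit points up to index \<open>n + 1\<close>, the last one in the pair.\<close>

definition code_pairs :: "nat \<Rightarrow> nat \<Rightarrow> ((nat \<Rightarrow> int) \<times> (nat \<Rightarrow> int)) set" where
  "code_pairs n r = {(code \<theta> \<eta> n, code \<theta> \<eta> (Suc n)) |\<theta> \<eta>. (\<theta>, \<eta>) \<in> params \<and> bad_count \<theta> \<eta> n \<le> r}"

lemma H_pos: "0 < H" unfolding H_def using b C R by auto

lemma rho: "0 < \<rho>" "\<rho> < 1/2" unfolding \<rho>_def using H_pos by (auto simp: field_simps)

lemma orbit_Suc: "orbit \<theta> \<eta> (Suc k) = \<theta> *\<^sub>R f (orbit \<theta> \<eta> k)"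
  by (simp add: orbit_def linear_scale[OF lin])

lemma norm_orbit: "0 \<le> \<theta> \<Longrightarrow> norm (orbit \<theta> \<eta> k) = \<theta> ^ k * norm \<eta>"
  by (induction k) (simp_all add: orbit_def[of _ _ 0] orbit_Suc iso)

lemma norm_diff_of_code_eq:
  assumes "rounding a m x = rounding a m y" "near_lattice a m e x" "near_lattice a m e y"
  shows "norm (x - y) \<le> C * (2 * e)"
proof (rule lower)
  fix j assume j: "j \<le> m"
  then have "round (x \<bullet> a j) = round (y \<bullet> a j)" using fun_cong[OF assms(1), of j] by (simp add: rounding_def)
  moreover have "\<bar>x \<bullet> a j - of_int (round (x \<bullet> a j))\<bar> \<le> e" "\<bar>y \<bullet> a j - of_int (round (y \<bullet> a j))\<bar> \<le> e"
    using assms j by (auto simp: near_lattice_def)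
  ultimately show "\<bar>(x - y) \<bullet> a j\<bar> \<le> 2 * e" by (simp add: inner_diff_left)
qed

text \<open>As \<open>f\<close> is an isometry, \<open>\<theta>\<close> is the ratio of successive
  norms, and equal codes fix these norms up to \<open>2 * C * e\<close>. Clearing denominators
  expresses \<open>(\<theta> - \<theta>') * norm y\<close> through differences of norms. The orbit
  norm grows exponentially, so the parameter is located with exponential precision.\<close>

lemma ratio_diff:
  assumes P: "(\<theta>, \<eta>) \<in> params" "(\<theta>', \<eta>') \<in> params"
    and eq: "code \<theta> \<eta> k = code \<theta>' \<eta>' k" "code \<theta> \<eta> (Suc k) = code \<theta>' \<eta>' (Suc k)"
    and e: "\<And>i. i \<in> {k, Suc k} \<Longrightarrow> near_lattice a m e (orbit \<theta> \<eta> i)"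
      "\<And>i. i \<in> {k, Suc k} \<Longrightarrow> near_lattice a m e (orbit \<theta>' \<eta>' i)"
  shows "\<bar>\<theta> - \<theta>'\<bar> * norm (orbit \<theta>' \<eta>' k) \<le> 2 * C * (1 + b') * e"
proof -
  let ?x = "orbit \<theta> \<eta>" and ?y = "orbit \<theta>' \<eta>'"
  have t: "0 \<le> \<theta>" "0 \<le> \<theta>'" "\<theta> \<le> b'" using P b by (auto simp: params_def)
  have d: "norm (?x i - ?y i) \<le> C * (2 * e)" if "i \<in> {k, Suc k}" for i
    using that eq e by (intro norm_diff_of_code_eq) auto
  have "norm (?x (Suc k)) = \<theta> * norm (?x k)" "norm (?y (Suc k)) = \<theta>' * norm (?y k)"
    using t by (simp_all add: norm_orbit)
  then have "(\<theta> - \<theta>') * norm (?y k) = (norm (?x (Suc k)) - norm (?y (Suc k))) - \<theta> * (norm (?x k) - norm (?y k))"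
    by (simp add: algebra_simps)
  then have "\<bar>\<theta> - \<theta>'\<bar> * norm (?y k) = \<bar>(norm (?x (Suc k)) - norm (?y (Suc k))) - \<theta> * (norm (?x k) - norm (?y k))\<bar>"
    by (metis abs_mult abs_norm_cancel)
  also have "\<dots> \<le> \<bar>norm (?x (Suc k)) - norm (?y (Suc k))\<bar> + \<theta> * \<bar>norm (?x k) - norm (?y k)\<bar>"
    using t by (metis abs_mult abs_of_nonneg abs_triangle_ineq4)
  also have "\<dots> \<le> C * (2 * e) + b' * (C * (2 * e))"
    using t d by (intro add_mono mult_mono order_trans[OF norm_triangle_ineq3]) auto
  finally show ?thesis by (simp add: algebra_simps)
qed

text \<open>The difference at \<open>k + 2\<close> splits into the error at \<open>k + 1\<close>
  scaled by \<open>\<theta>\<close> and a term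
  \<open>\<bar>\<theta> - \<theta>'\<bar> * norm y\<close> at \<open>k + 1\<close>. The large norm
  is harmless because \<open>ratio_diff\<close> bounds exactly this product, up to a factor
  \<open>\<theta>'\<close>. The 2 in \<open>H + 2\<close> accounts for the two rounding errors at
  \<open>k + 2\<close>.\<close>

lemma code_step:
  assumes P: "(\<theta>, \<eta>) \<in> params" "(\<theta>', \<eta>') \<in> params"
    and eq: "code \<theta> \<eta> k = code \<theta>' \<eta>' k" "code \<theta> \<eta> (Suc k) = code \<theta>' \<eta>' (Suc k)"
    and e: "\<And>i. i \<in> {k, k+1, k+2} \<Longrightarrow> near_lattice a m e (orbit \<theta> \<eta> i)"
      "\<And>i. i \<in> {k, k+1, k+2} \<Longrightarrow> near_lattice a m e (orbit \<theta>' \<eta>' i)"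
    and j: "j \<le> m"
  shows "\<bar>real_of_int (code \<theta> \<eta> (k+2) j - code \<theta>' \<eta>' (k+2) j)\<bar> \<le> (H + 2) * e"
proof -
  let ?x = "orbit \<theta> \<eta>" and ?y = "orbit \<theta>' \<eta>'"
  have t: "0 \<le> \<theta>" "0 \<le> \<theta>'" "\<theta> \<le> b'" "\<theta>' \<le> b'" using P b by (auto simp: params_def)
  have r: "\<bar>\<theta> - \<theta>'\<bar> * norm (?y k) \<le> 2 * C * (1 + b') * e"
    by (rule ratio_diff[OF P eq]) (use e in auto)
  have d: "norm (?x (Suc k) - ?y (Suc k)) \<le> C * (2 * e)"
    by (rule norm_diff_of_code_eq[OF eq(2)]) (use e in auto)
  have "?x (k+2) - ?y (k+2) = \<theta> *\<^sub>R f (?x (Suc k) - ?y (Suc k)) + (\<theta> - \<theta>') *\<^sub>R f (?y (Suc k))"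
    by (simp add: orbit_Suc linear_diff[OF lin] algebra_simps)
  then have "norm (?x (k+2) - ?y (k+2)) \<le> \<theta> * norm (?x (Suc k) - ?y (Suc k)) + \<bar>\<theta> - \<theta>'\<bar> * norm (?y (Suc k))"
    using norm_triangle_ineq[of "\<theta> *\<^sub>R f (?x (Suc k) - ?y (Suc k))" "(\<theta> - \<theta>') *\<^sub>R f (?y (Suc k))"] t
    by (simp add: iso)
  also have "\<bar>\<theta> - \<theta>'\<bar> * norm (?y (Suc k)) = \<theta>' * (\<bar>\<theta> - \<theta>'\<bar> * norm (?y k))"
    using t by (simp add: norm_orbit)
  also have "\<theta> * norm (?x (Suc k) - ?y (Suc k)) + \<theta>' * (\<bar>\<theta> - \<theta>'\<bar> * norm (?y k))
      \<le> b' * (C * (2 * e)) + b' * (2 * C * (1 + b') * e)"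
    using t d r by (intro add_mono mult_mono[of \<theta>] mult_mono[of \<theta>' b']) auto
  finally have n: "norm (?x (k+2) - ?y (k+2)) \<le> 2 * C * b' * (2 + b') * e"
    by (simp add: algebra_simps)
  have "\<bar>(?x (k+2) - ?y (k+2)) \<bullet> a j\<bar> \<le> norm (?x (k+2) - ?y (k+2)) * norm (a j)"
    by (rule Cauchy_Schwarz_ineq2)
  also have "\<dots> \<le> (2 * C * b' * (2 + b') * e) * R"
    by (rule mult_mono[OF n upper[OF j] order_trans[OF norm_ge_zero n] norm_ge_zero])
  finally have "\<bar>(?x (k+2) - ?y (k+2)) \<bullet> a j\<bar> \<le> H * e" by (simp add: H_def mult_ac)
  moreover have "\<bar>?x (k+2) \<bullet> a j - of_int (code \<theta> \<eta> (k+2) j)\<bar> \<le> e" "\<bar>?y (k+2) \<bullet> a j - of_int (code \<theta>' \<eta>' (k+2) j)\<bar> \<le> e"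
    using e[of "k+2"] j by (auto simp: near_lattice_def rounding_def)
  ultimately show ?thesis by (simp add: inner_diff_left distrib_right)
qed

lemma code_step_good:
  assumes P: "(\<theta>, \<eta>) \<in> params" "(\<theta>', \<eta>') \<in> params"
    and eq: "code \<theta> \<eta> k = code \<theta>' \<eta>' k" "code \<theta> \<eta> (Suc k) = code \<theta>' \<eta>' (Suc k)"
    and g: "good_step \<theta> \<eta> k" "good_step \<theta>' \<eta>' k"
  shows "code \<theta> \<eta> (Suc (Suc k)) = code \<theta>' \<eta>' (Suc (Suc k))"
proof
  fix j
  show "code \<theta> \<eta> (Suc (Suc k)) j = code \<theta>' \<eta>' (Suc (Suc k)) j"
  proof (cases "j \<le> m")
    case True
    have "\<bar>real_of_int (code \<theta> \<eta> (k+2) j - code \<theta>' \<eta>' (k+2) j)\<bar> \<le> (H + 2) * \<rho>"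
      by (rule code_step[OF P eq]) (use g True in \<open>auto simp: good_step_def\<close>)
    also have "\<dots> < 1" using H_pos by (simp add: \<rho>_def)
    finally have "\<bar>code \<theta> \<eta> (k+2) j - code \<theta>' \<eta>' (k+2) j\<bar> < 1" by linarith
    then show ?thesis by simp
  qed (simp add: rounding_def)
qed

lemma code_step_any:
  assumes P: "(\<theta>, \<eta>) \<in> params" "(\<theta>', \<eta>') \<in> params"
    and eq: "code \<theta> \<eta> k = code \<theta>' \<eta>' k" "code \<theta> \<eta> (Suc k) = code \<theta>' \<eta>' (Suc k)"
  shows "(\<lambda>j. code \<theta> \<eta> (Suc (Suc k)) j - code \<theta>' \<eta>' (Suc (Suc k)) j) \<in> int_box m ((H + 2) * (1/2))"
  using code_step[OF P eq near_lattice_half near_lattice_half]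
  by (auto simp: int_box_def rounding_def)

section \<open>Counting the codes of orbits with few bad steps\<close>

definition B :: nat where "B = card (int_box m ((H + 2) * (1/2)))"

text \<open>\<open>B\<close> bounds the continuations of a code pair at any step, and
  \<open>D\<close> the number of initial pairs: the orbit has norm at most \<open>b'\<close> at time
  0 and \<open>b' * b'\<close> at time 1.\<close>

definition D :: nat where "D = card (int_box m (b' * R + 1) \<times> int_box m (b' * b' * R + 1))"

lemma bad_count_Suc: "bad_count \<theta> \<eta> (Suc n) = bad_count \<theta> \<eta> n + (if good_step \<theta> \<eta> n then 0 else 1)"
proof -
  have "{k. k < Suc n \<and> \<not> good_step \<theta> \<eta> k} =
      (if good_step \<theta> \<eta> n then {k. k < n \<and> \<not> good_step \<theta> \<eta> k} else insert n {k. k < n \<and> \<not> good_step \<theta> \<eta> k})"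
    by (auto simp: less_Suc_eq)
  then show ?thesis by (simp add: bad_count_def)
qed

lemma code_in_box:
  assumes "norm (orbit \<theta> \<eta> k) \<le> c"
  shows "code \<theta> \<eta> k \<in> int_box m (c * R + 1)"
proof -
  have "\<bar>real_of_int (round (orbit \<theta> \<eta> k \<bullet> a j))\<bar> \<le> c * R + 1" if "j \<le> m" for j
  proof -
    have "\<bar>orbit \<theta> \<eta> k \<bullet> a j\<bar> \<le> norm (orbit \<theta> \<eta> k) * norm (a j)" by (rule Cauchy_Schwarz_ineq2)
    also have "\<dots> \<le> c * R" using assms upper[OF that] by (intro mult_mono) (auto intro: order_trans[OF norm_ge_zero])
    finally show ?thesis using of_int_round_abs_le[of "orbit \<theta> \<eta> k \<bullet> a j"] by linarith
  qed
  then show ?thesis by (auto simp: int_box_def rounding_def)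
qed

lemma code_pairs_0: "finite (code_pairs 0 r) \<and> card (code_pairs 0 r) \<le> D"
proof -
  have "code_pairs 0 r \<subseteq> int_box m (b' * R + 1) \<times> int_box m (b' * b' * R + 1)"
  proof
    fix z assume "z \<in> code_pairs 0 r"
    then obtain \<theta> \<eta> where z: "z = (code \<theta> \<eta> 0, code \<theta> \<eta> (Suc 0))" and P: "(\<theta>, \<eta>) \<in> params"
      by (auto simp: code_pairs_def)
    have "norm (orbit \<theta> \<eta> 0) \<le> b'" "norm (orbit \<theta> \<eta> (Suc 0)) \<le> b' * b'"
      using P b by (auto simp: params_def norm_orbit intro!: mult_mono)
    then show "z \<in> int_box m (b' * R + 1) \<times> int_box m (b' * b' * R + 1)"
      using z code_in_box by blast
  qed
  then show ?thesis unfolding D_def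
    by (meson card_mono finite_SigmaI finite_int_box finite_subset)
qed

definition successors :: "bool \<Rightarrow> nat \<Rightarrow> (nat \<Rightarrow> int) \<times> (nat \<Rightarrow> int) \<Rightarrow> ((nat \<Rightarrow> int) \<times> (nat \<Rightarrow> int)) set" where
  "successors g n x = {z. \<exists>\<theta> \<eta>. (\<theta>, \<eta>) \<in> params \<and> code \<theta> \<eta> n = fst x \<and> code \<theta> \<eta> (Suc n) = snd x \<and>
     z = (snd x, code \<theta> \<eta> (Suc (Suc n))) \<and> (g \<longrightarrow> good_step \<theta> \<eta> n)}"

lemma successorsE:
  assumes "z \<in> successors g n x"
  obtains \<theta> \<eta> where "(\<theta>, \<eta>) \<in> params" "code \<theta> \<eta> n = fst x" "code \<theta> \<eta> (Suc n) = snd x"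
    "z = (snd x, code \<theta> \<eta> (Suc (Suc n)))" "g \<Longrightarrow> good_step \<theta> \<eta> n"
  using assms unfolding successors_def mem_Collect_eq by (elim exE conjE) blast

lemma successors_good: "finite (successors True n x) \<and> card (successors True n x) \<le> 1"
proof (rule card_le_1_if_all_eq)
  fix z w assume z: "z \<in> successors True n x" and w: "w \<in> successors True n x"
  from z obtain \<theta> \<eta> where 1: "(\<theta>, \<eta>) \<in> params" "code \<theta> \<eta> n = fst x" "code \<theta> \<eta> (Suc n) = snd x"
    "z = (snd x, code \<theta> \<eta> (Suc (Suc n)))" "good_step \<theta> \<eta> n" by (rule successorsE) simp
  from w obtain \<theta>' \<eta>' where 2: "(\<theta>', \<eta>') \<in> params" "code \<theta>' \<eta>' n = fst x" "code \<theta>' \<eta>' (Suc n) = snd x"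
    "w = (snd x, code \<theta>' \<eta>' (Suc (Suc n)))" "good_step \<theta>' \<eta>' n" by (rule successorsE) simp
  have "code \<theta> \<eta> (Suc (Suc n)) = code \<theta>' \<eta>' (Suc (Suc n))"
    by (rule code_step_good[OF 1(1) 2(1) _ _ 1(5) 2(5)]) (simp_all only: 1 2)
  then show "z = w" by (simp only: 1(4) 2(4))
qed

lemma successors_any: "finite (successors False n x) \<and> card (successors False n x) \<le> B"
proof -
  have box: "finite (snd ` successors False n x) \<and> card (snd ` successors False n x) \<le> B"
    unfolding B_def
  proof (rule card_le_int_box)
    fix z w assume "z \<in> snd ` successors False n x" "w \<in> snd ` successors False n x"
    then obtain z' w' where z: "z' \<in> successors False n x" "z = snd z'"
      and w: "w' \<in> successors False n x" "w = snd w'" by blast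
    from z(1) obtain \<theta> \<eta> where 1: "(\<theta>, \<eta>) \<in> params" "code \<theta> \<eta> n = fst x" "code \<theta> \<eta> (Suc n) = snd x"
      "z' = (snd x, code \<theta> \<eta> (Suc (Suc n)))" by (rule successorsE)
    from w(1) obtain \<theta>' \<eta>' where 2: "(\<theta>', \<eta>') \<in> params" "code \<theta>' \<eta>' n = fst x" "code \<theta>' \<eta>' (Suc n) = snd x"
      "w' = (snd x, code \<theta>' \<eta>' (Suc (Suc n)))" by (rule successorsE)
    show "(\<lambda>j. z j - w j) \<in> int_box m ((H + 2) * (1/2))"
      unfolding z(2) w(2) 1(4) 2(4) snd_conv
      by (rule code_step_any[OF 1(1) 2(1)]) (simp_all only: 1 2)
  qed
  \<comment> \<open>All continuations of \<open>x\<close> have the first component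
    \<open>snd x\<close>, so it suffices to count second components.\<close>
  have "z = w" if "z \<in> successors False n x" "w \<in> successors False n x" "snd z = snd w" for z w
    using that by (elim successorsE) simp
  then have inj: "inj_on snd (successors False n x)"
    by (rule inj_onI)
  show ?thesis using box inj by (simp only: finite_image_iff card_image simp_thms)
qed

lemma successorsI:
  assumes "(\<theta>, \<eta>) \<in> params" "g \<Longrightarrow> good_step \<theta> \<eta> n"
  shows "(code \<theta> \<eta> (Suc n), code \<theta> \<eta> (Suc (Suc n))) \<in> successors g n (code \<theta> \<eta> n, code \<theta> \<eta> (Suc n))"
  unfolding successors_def mem_Collect_eq fst_conv snd_conv
  by (rule exI[of _ \<theta>], rule exI[of _ \<eta>], intro conjI impI refl assms)

lemma mem_code_pairs:
  "(\<theta>, \<eta>) \<in> params \<Longrightarrow> bad_count \<theta> \<eta> n \<le> r \<Longrightarrow> (code \<theta> \<eta> n, code \<theta> \<eta> (Suc n)) \<in> code_pairs n r"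
  unfolding code_pairs_def by blast

text \<open>A recursion of Pascal type: a good last step has at most one continuation and keeps the
  allowance \<open>r\<close>, a bad one has at most \<open>B\<close> continuations and uses up one
  unit. For \<open>r = 0\<close> only good steps remain.\<close>

lemma code_pairs_Suc:
  assumes fin: "\<And>r. finite (code_pairs n r)"
  shows "finite (code_pairs (Suc n) r) \<and> card (code_pairs (Suc n) r) \<le>
    card (code_pairs n r) + (if r = 0 then 0 else card (code_pairs n (r - 1)) * B)"
proof -
  define G where "G = (\<Union>x\<in>code_pairs n r. successors True n x)"
  define L where "L = (if r = 0 then {} else \<Union>x\<in>code_pairs n (r - 1). successors False n x)"
  have G: "finite G \<and> card G \<le> card (code_pairs n r) * 1"
    unfolding G_def by (rule card_le_mult_fibres[OF fin order_refl successors_good])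
  have L: "finite L \<and> card L \<le> (if r = 0 then 0 else card (code_pairs n (r - 1)) * B)"
  proof (cases "r = 0")
    case False
    then show ?thesis unfolding L_def if_not_P[OF False]
      by (intro card_le_mult_fibres[OF fin order_refl successors_any])
  qed (simp add: L_def)
  have sub: "code_pairs (Suc n) r \<subseteq> G \<union> L"
  proof
    fix z assume "z \<in> code_pairs (Suc n) r"
    then obtain \<theta> \<eta> where z: "z = (code \<theta> \<eta> (Suc n), code \<theta> \<eta> (Suc (Suc n)))"
      and P: "(\<theta>, \<eta>) \<in> params" and bad: "bad_count \<theta> \<eta> (Suc n) \<le> r"
      unfolding code_pairs_def by blast
    show "z \<in> G \<union> L"
    proof (cases "good_step \<theta> \<eta> n")
      case True
      then have "bad_count \<theta> \<eta> n \<le> r" using bad bad_count_Suc[of \<theta> \<eta> n] by simp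
      from mem_code_pairs[OF P this] successorsI[OF P True] have "z \<in> G"
        unfolding G_def z by (rule UN_I)
      then show ?thesis ..
    next
      case False
      then have r: "r \<noteq> 0" and "bad_count \<theta> \<eta> n \<le> r - 1"
        using bad bad_count_Suc[of \<theta> \<eta> n] by simp_all
      from mem_code_pairs[OF P this(2)] successorsI[OF P] have "z \<in> L"
        unfolding L_def z if_not_P[OF r] by (rule UN_I) simp
      then show ?thesis ..
    qed
  qed
  have fin': "finite (G \<union> L)" using G L by simp
  have "card (code_pairs (Suc n) r) \<le> card G + card L"
    using card_mono[OF fin' sub] card_Un_le[of G L] by (rule order_trans)
  also have "\<dots> \<le> card (code_pairs n r) * 1 + (if r = 0 then 0 else card (code_pairs n (r - 1)) * B)"
    by (rule add_mono[OF conjunct2[OF G] conjunct2[OF L]])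
  finally show ?thesis using finite_subset[OF sub fin'] by (simp only: mult_1_right simp_thms)
qed

lemma finite_code_pairs: "finite (code_pairs n r)"
  using code_pairs_0 code_pairs_Suc by (induction n arbitrary: r) blast+

text \<open>
  Each bad step costs a factor \<open>B\<close>. Weighting it by \<open>t\<close> replaces the binomial count of the positions of at most
  \<open>r\<close> bad steps by \<open>(1 + t B)\<^sup>n / t\<^sup>r\<close>; with \<open>r\<close> a small multiple of \<open>n\<close> the growth rate is as close to 1 as desired.
\<close>

lemma card_code_pairs:
  fixes t :: real
  assumes t: "0 < t" "t \<le> 1"
  shows "real (card (code_pairs n r)) \<le> D * (1 + t * B) ^ n * (1 / t) ^ r"
proof (induction n arbitrary: r)
  case 0
  have "real (card (code_pairs 0 r)) \<le> real D * 1" using code_pairs_0 by simp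
  also have "\<dots> \<le> D * (1 / t) ^ r" using t by (intro mult_left_mono one_le_power) (auto simp: field_simps)
  finally show ?case by simp
next
  case (Suc n)
  have "real (card (code_pairs (Suc n) r)) \<le>
      real (card (code_pairs n r) + (if r = 0 then 0 else card (code_pairs n (r - 1)) * B))"
    using code_pairs_Suc finite_code_pairs by (intro of_nat_mono) blast
  also have "\<dots> \<le> D * (1 + t * B) ^ n * (1 / t) ^ r + D * (1 + t * B) ^ n * (1 / t) ^ r * (t * B)"
  proof (cases r)
    case 0
    then show ?thesis using Suc[of 0] t by (simp add: add_increasing2)
  next
    case (Suc r')
    have "real (card (code_pairs n r')) * B \<le> (D * (1 + t * B) ^ n * (1 / t) ^ r') * B"
      by (intro mult_right_mono Suc.IH) simp
    also have "\<dots> = D * (1 + t * B) ^ n * (1 / t) ^ r * (t * B)" using t Suc by simp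
    finally show ?thesis using Suc.IH[of r] Suc by simp
  qed
  finally show ?case by (simp add: algebra_simps)
qed

section \<open>Covering the exceptional parameters\<close>

definition exceptional :: "nat \<Rightarrow> nat \<Rightarrow> real set" where
  "exceptional n r = {\<theta>. \<exists>\<eta>. (\<theta>, \<eta>) \<in> params \<and> bad_count \<theta> \<eta> n \<le> r}"

definition cell :: "nat \<Rightarrow> (nat \<Rightarrow> int) \<times> (nat \<Rightarrow> int) \<Rightarrow> real set" where
  "cell n z = {\<theta>. \<exists>\<eta>. (\<theta>, \<eta>) \<in> params \<and> z = (code \<theta> \<eta> n, code \<theta> \<eta> (Suc n))}"

lemma exceptional_subset: "exceptional n r \<subseteq> (\<Union>z\<in>code_pairs n r. cell n z)"
  unfolding exceptional_def cell_def code_pairs_def by blast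

text \<open>This is \<open>ratio_diff\<close> with the trivial error 1/2; the orbit norm at
  \<open>n\<close> is at least \<open>b ^ n\<close> because
  \<open>norm \<eta>' \<ge> 1\<close>.\<close>

lemma cell_diameter:
  "bounded (cell n z)" "diameter (cell n z) \<le> C * (1 + b') / b ^ n"
proof -
  have "cell n z \<subseteq> {b..b'}" by (auto simp: cell_def params_def)
  then show "bounded (cell n z)" using bounded_closed_interval bounded_subset by blast
  have "dist \<theta> \<theta>' \<le> C * (1 + b') / b ^ n" if cell: "\<theta> \<in> cell n z" "\<theta>' \<in> cell n z" for \<theta> \<theta>'
  proof -
    obtain \<eta> \<eta>' where P: "(\<theta>, \<eta>) \<in> params" "(\<theta>', \<eta>') \<in> params"
      and eq: "code \<theta> \<eta> n = code \<theta>' \<eta>' n" "code \<theta> \<eta> (Suc n) = code \<theta>' \<eta>' (Suc n)"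
      using cell by (auto simp: cell_def)
    have "b ^ n * 1 \<le> \<theta>' ^ n * norm \<eta>'"
      using P b by (intro mult_mono power_mono) (auto simp: params_def)
    also have "\<dots> = norm (orbit \<theta>' \<eta>' n)"
      using P b by (subst norm_orbit) (auto simp: params_def)
    finally have "\<bar>\<theta> - \<theta>'\<bar> * b ^ n \<le> \<bar>\<theta> - \<theta>'\<bar> * norm (orbit \<theta>' \<eta>' n)"
      by (intro mult_left_mono) auto
    also have "\<dots> \<le> 2 * C * (1 + b') * (1/2)"
      by (intro ratio_diff[OF P eq] near_lattice_half)
    finally show ?thesis using b by (simp add: dist_real_def pos_le_divide_eq)
  qed
  then show "diameter (cell n z) \<le> C * (1 + b') / b ^ n"
    using b C by (intro diameter_le) (auto simp: dist_norm)
qed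

section \<open>From far indices to power decay\<close>

definition far_count :: "real \<Rightarrow> 'a \<Rightarrow> nat \<Rightarrow> nat" where
  "far_count \<theta> \<eta> n = card {k. k \<le> n \<and> \<not> near_lattice a m \<rho> (orbit \<theta> \<eta> k)}"

text \<open>A bad step at \<open>k\<close> needs a far index among \<open>k\<close>,
  \<open>k + 1\<close>, \<open>k + 2\<close>, so a far index spoils at most three steps. The
  argument \<open>Suc n\<close> arises because \<open>k + 2 \<le> n + 1\<close> for
  \<open>k < n\<close>.\<close>

lemma bad_count_le: "bad_count \<theta> \<eta> n \<le> 3 * far_count \<theta> \<eta> (Suc n)"
proof -
  define N where "N = {k. k \<le> Suc n \<and> \<not> near_lattice a m \<rho> (orbit \<theta> \<eta> k)}"
  have fin: "finite N" by (simp add: N_def)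
  have "{k. k < n \<and> \<not> good_step \<theta> \<eta> k} \<subseteq> N \<union> (\<lambda>k. k - 1) ` N \<union> (\<lambda>k. k - 2) ` N"
  proof
    fix k assume "k \<in> {k. k < n \<and> \<not> good_step \<theta> \<eta> k}"
    then have "k \<in> N \<or> k + 1 \<in> N \<or> k + 2 \<in> N" by (auto simp: good_step_def N_def)
    moreover have "k + 1 \<in> N \<Longrightarrow> k \<in> (\<lambda>k. k - 1) ` N" "k + 2 \<in> N \<Longrightarrow> k \<in> (\<lambda>k. k - 2) ` N"
      by (simp_all add: rev_image_eqI)
    ultimately show "k \<in> N \<union> (\<lambda>k. k - 1) ` N \<union> (\<lambda>k. k - 2) ` N" by blast
  qed
  then have "bad_count \<theta> \<eta> n \<le> card (N \<union> (\<lambda>k. k - 1) ` N \<union> (\<lambda>k. k - 2) ` N)"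
    unfolding bad_count_def using fin by (intro card_mono) auto
  also have "\<dots> \<le> card N + card ((\<lambda>k. k - 1) ` N) + card ((\<lambda>k. k - 2) ` N)"
    by (intro order_trans[OF card_Un_le] add_mono card_Un_le order_refl)
  also have "\<dots> \<le> card N + card N + card N"
    using fin by (intro add_mono card_image_le order_refl)
  finally show ?thesis by (simp add: far_count_def N_def)
qed

lemma far_count_Suc:
  "far_count \<theta> \<eta> (Suc n) = far_count \<theta> \<eta> n + (if near_lattice a m \<rho> (orbit \<theta> \<eta> (Suc n)) then 0 else 1)"
proof -
  have "{k. k \<le> Suc n \<and> \<not> near_lattice a m \<rho> (orbit \<theta> \<eta> k)} =
      (if near_lattice a m \<rho> (orbit \<theta> \<eta> (Suc n)) then {k. k \<le> n \<and> \<not> near_lattice a m \<rho> (orbit \<theta> \<eta> k)}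
       else insert (Suc n) {k. k \<le> n \<and> \<not> near_lattice a m \<rho> (orbit \<theta> \<eta> k)})"
    by (auto simp: le_Suc_eq)
  then show ?thesis by (simp add: far_count_def)
qed

lemma far_count_0: "far_count \<theta> \<eta> 0 = (if near_lattice a m \<rho> (orbit \<theta> \<eta> 0) then 0 else 1)"
proof -
  have "{k. k \<le> 0 \<and> \<not> near_lattice a m \<rho> (orbit \<theta> \<eta> k)} =
      (if near_lattice a m \<rho> (orbit \<theta> \<eta> 0) then {} else {0})" by (auto intro!: gr0I)
  then show ?thesis by (simp add: far_count_def)
qed

text \<open>\<open>f\<close> is a linear isometry of a finite-dimensional space, hence bijective,
  and can be inverted along the orbit; \<open>N\<close> is the exponent with
  \<open>\<theta> ^ N \<le> norm \<xi> < \<theta> ^ (N + 1)\<close>.\<close>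

lemma obtain_orbit:
  assumes "1 < \<theta>" "1 \<le> norm \<xi>"
  obtains \<eta> N where "\<xi> = orbit \<theta> \<eta> N" "1 \<le> norm \<eta>" "norm \<eta> \<le> \<theta>"
proof -
  obtain N0 where "norm \<xi> < \<theta> ^ N0" using real_arch_pow[OF assms(1)] by blast
  then obtain N where N: "norm \<xi> < \<theta> ^ Suc N" "\<not> norm \<xi> < \<theta> ^ N"
    using assms(2) ex_least_nat_less[of "\<lambda>n. norm \<xi> < \<theta> ^ n" N0] by (auto simp: not_less)
  have "inj f"
    using lin iso by (metis linear_injective_0 norm_eq_zero)
  then have "surj f" using lin by (simp add: linear_injective_imp_surjective)
  then have "surj (f ^^ N)" by (rule surj_fn)
  then obtain \<eta> where \<eta>: "(f ^^ N) \<eta> = inverse (\<theta> ^ N) *\<^sub>R \<xi>" by (metis surjD)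
  have orb: "\<xi> = orbit \<theta> \<eta> N" using assms by (simp add: orbit_def \<eta>)
  then have "norm \<xi> = \<theta> ^ N * norm \<eta>" using norm_orbit[of \<theta> \<eta> N] assms by simp
  then have "\<theta> ^ N * norm \<eta> < \<theta> ^ N * \<theta>" "\<theta> ^ N * 1 \<le> \<theta> ^ N * norm \<eta>"
    using N by (simp_all add: mult.commute)
  then have "norm \<eta> < \<theta>" "1 \<le> norm \<eta>"
    using assms by (simp_all only: mult_less_cancel_left_pos mult_le_cancel_left_pos zero_less_power)
  then show thesis using that[OF orb] by simp
qed

text \<open>If \<open>\<theta>\<close> is not exceptional at \<open>n\<close>, every admissible
  orbit has more than \<open>n div l\<close> bad steps, hence at least \<open>n / (3 * l)\<close>
  far indices, and \<open>g\<close> is at most \<open>\<kappa> ^ n\<close>. As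
  \<open>norm \<xi>\<close> is at most \<open>\<theta> ^ (n + 2)\<close>, this is power
  decay.\<close>

lemma decay_of_not_exceptional:
  fixes g :: "'a \<Rightarrow> real"
  assumes \<theta>: "b \<le> \<theta>" "\<theta> \<le> b'" and \<sigma>: "0 < \<sigma>" "\<sigma> < 1" and "0 < l"
    and ev: "eventually (\<lambda>n. \<theta> \<notin> exceptional n (n div l)) sequentially"
    and g: "\<And>\<eta> N. g (orbit \<theta> \<eta> N) \<le> \<sigma> ^ far_count \<theta> \<eta> N"
  obtains \<gamma> K where "0 < \<gamma>" "eventually (\<lambda>\<xi>. g \<xi> \<le> K * norm \<xi> powr (- \<gamma>)) at_infinity"
proof -
  obtain n0 where n0: "\<And>n. n0 \<le> n \<Longrightarrow> \<theta> \<notin> exceptional n (n div l)"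
    using ev by (auto simp: eventually_sequentially)
  have "1 < \<theta>" using \<theta> b by simp
  \<comment> \<open>A factor \<open>\<sigma>\<close> for each of \<open>n / (3 * l)\<close> far
    indices amounts to a factor \<open>\<kappa>\<close> for each of \<open>n\<close> steps; the 3
    comes from \<open>bad_count_le\<close>.\<close>
  define \<kappa> where "\<kappa> = \<sigma> powr (1 / (3 * l))"
  have \<kappa>: "0 < \<kappa>" "\<kappa> < 1" using \<sigma> \<open>0 < l\<close> powr_less_mono2[of "1 / (3 * l)" \<sigma> 1] by (auto simp: \<kappa>_def)
  have \<kappa>_pow: "\<kappa> ^ (3 * l) = \<sigma>"
    using \<sigma> \<open>0 < l\<close> by (simp add: \<kappa>_def powr_powr flip: powr_realpow)
  define \<gamma> where "\<gamma> = - ln \<kappa> / ln \<theta>"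
  have "0 < \<gamma>" using \<kappa> \<open>1 < \<theta>\<close> by (simp add: \<gamma>_def divide_neg_pos)
  have \<theta>\<gamma>: "\<theta> powr (- \<gamma>) = \<kappa>" using \<kappa> \<open>1 < \<theta>\<close> by (simp add: \<gamma>_def powr_def)
  \<comment> \<open>The threshold gives \<open>n0 \<le> n\<close> for \<open>N = n + 1\<close>, as
    \<open>norm \<xi> \<le> \<theta> ^ (N + 1)\<close>. The constant
    \<open>inverse (\<kappa>\<^sup>2)\<close> pays for passing from the exponent \<open>n\<close> to
    \<open>N + 1 = n + 2\<close>.\<close>
  have "g \<xi> \<le> inverse (\<kappa>\<^sup>2) * norm \<xi> powr (- \<gamma>)" if \<xi>: "\<theta> ^ (n0 + 2) \<le> norm \<xi>" for \<xi>
  proof -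
    have "1 \<le> norm \<xi>" using \<xi> \<open>1 < \<theta>\<close> by (meson less_imp_le one_le_power order_trans)
    with \<open>1 < \<theta>\<close> obtain \<eta> N where orb: "\<xi> = orbit \<theta> \<eta> N" and \<eta>: "1 \<le> norm \<eta>" "norm \<eta> \<le> \<theta>"
      by (rule obtain_orbit)
    have "norm \<xi> = \<theta> ^ N * norm \<eta>" using norm_orbit[of \<theta> \<eta> N] orb \<open>1 < \<theta>\<close> by simp
    also have "\<dots> \<le> \<theta> ^ N * \<theta>" using \<eta> \<open>1 < \<theta>\<close> by (intro mult_left_mono) auto
    finally have le: "norm \<xi> \<le> \<theta> ^ Suc N" by (simp add: mult.commute)
    then have "\<theta> ^ (n0 + 2) \<le> \<theta> ^ Suc N" using \<xi> by (rule order_trans[rotated])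
    then have "n0 + 2 \<le> Suc N" using \<open>1 < \<theta>\<close> by (rule power_le_imp_le_exp[rotated])
    then obtain n where N: "N = Suc n" and "n0 \<le> n" by (cases N) auto
    have "(\<theta>, \<eta>) \<in> params" using \<theta> \<eta> by (simp add: params_def)
    then have "n div l < bad_count \<theta> \<eta> n"
      using n0[OF \<open>n0 \<le> n\<close>] by (auto simp: exceptional_def not_le)
    then have "n div l < 3 * far_count \<theta> \<eta> N"
      using bad_count_le[of \<theta> \<eta> n] unfolding N by (rule less_le_trans)
    then have "n \<le> 3 * far_count \<theta> \<eta> N * l"
      using \<open>0 < l\<close> by (simp only: div_less_iff_less_mult less_imp_le)
    have "\<kappa> ^ Suc N = (\<theta> powr (- \<gamma>)) powr real (Suc N)"
      unfolding \<theta>\<gamma> using \<kappa>(1) by (rule powr_realpow[symmetric])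
    also have "\<dots> = (\<theta> powr real (Suc N)) powr (- \<gamma>)" by (simp only: powr_powr mult.commute)
    also have "\<theta> powr real (Suc N) = \<theta> ^ Suc N" using \<open>1 < \<theta>\<close> by (intro powr_realpow) simp
    finally have \<kappa>_eq: "\<kappa> ^ Suc N = (\<theta> ^ Suc N) powr (- \<gamma>)" .
    have "g \<xi> \<le> \<sigma> ^ far_count \<theta> \<eta> N" unfolding orb by (rule g)
    also have "\<dots> = \<kappa> ^ (3 * far_count \<theta> \<eta> N * l)"
      by (simp add: mult_ac flip: \<kappa>_pow power_mult)
    also have "\<dots> \<le> \<kappa> ^ n"
      using \<kappa> \<open>n \<le> 3 * far_count \<theta> \<eta> N * l\<close> by (intro power_decreasing) auto
    also have "\<dots> = inverse (\<kappa>\<^sup>2) * \<kappa> ^ Suc N" using \<kappa> by (simp add: N power2_eq_square field_simps)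
    also have "\<kappa> ^ Suc N = (\<theta> ^ Suc N) powr (- \<gamma>)" by (rule \<kappa>_eq)
    also have "inverse (\<kappa>\<^sup>2) * \<dots> \<le> inverse (\<kappa>\<^sup>2) * norm \<xi> powr (- \<gamma>)"
      using \<open>1 \<le> norm \<xi>\<close> le \<open>0 < \<gamma>\<close> by (intro mult_left_mono powr_mono2') auto
    finally show ?thesis .
  qed
  then show thesis
    using that[OF \<open>0 < \<gamma>\<close>, of "inverse (\<kappa>\<^sup>2)"] by (auto simp: eventually_at_infinity)
qed

text \<open>At most \<open>D * (1 + t * B) ^ n * (1 / t) ^ (n div l)\<close> cells are needed, each
  of gauge at most \<open>(c / b ^ n) powr s\<close>, which is
  \<open>c powr s / \<beta> ^ (2 * n)\<close>. One factor \<open>\<beta> ^ n\<close> absorbs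
  \<open>(1 / t) ^ (n div l)\<close>, the other beats \<open>(1 + t * B) ^ n\<close>, and the
  premeasures are summable. The choice of \<open>l\<close> depends on \<open>s\<close> but not on
  \<open>\<delta>\<close> or \<open>E\<close>.\<close>

lemma premeasure_limsup_exceptional:
  assumes "0 < s"
  obtains l where "0 < l" "\<And>\<delta> E. 0 < \<delta> \<Longrightarrow>
    (\<And>\<theta>. \<theta> \<in> E \<Longrightarrow> frequently (\<lambda>n. \<theta> \<in> exceptional n (n div l)) sequentially) \<Longrightarrow>
    hausdorff_premeasure s \<delta> E = 0"
proof -
  define \<beta> where "\<beta> = b powr (s / 2)"
  have \<beta>: "1 < \<beta>" unfolding \<beta>_def using b \<open>0 < s\<close> by (intro gr_one_powr) auto
  \<comment> \<open>Small enough that \<open>1 + t * B < \<beta>\<close>, and at most 1 as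
    \<open>card_code_pairs\<close> requires.\<close>
  define t where "t = min 1 ((\<beta> - 1) / (2 * (real B + 1)))"
  have t: "0 < t" "t \<le> 1" using \<beta> by (auto simp: t_def)
  have "t * B \<le> (\<beta> - 1) / (2 * (real B + 1)) * (real B + 1)"
    using \<beta> t by (intro mult_mono) (auto simp: t_def)
  also have "\<dots> = (\<beta> - 1) / 2" by (simp add: field_simps)
  also have "\<dots> < \<beta> - 1" using \<beta> by simp
  finally have tB: "1 + t * B < \<beta>" by simp
  obtain l where l: "1 / t < \<beta> ^ l" using real_arch_pow[OF \<beta>] by blast
  \<comment> \<open>\<open>l = 0\<close> would give \<open>1 / t < 1\<close>, against
    \<open>t \<le> 1\<close>.\<close>
  have "l \<noteq> 0" using l t by (intro notI) (simp add: field_simps)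
  define c where "c = C * (1 + b')"
  have c: "0 < c" using C b by (simp add: c_def)
  show thesis
  proof (rule that[of l])
    show "0 < l" using \<open>l \<noteq> 0\<close> by simp
    fix \<delta> :: real and E assume "0 < \<delta>"
      and E: "\<And>\<theta>. \<theta> \<in> E \<Longrightarrow> frequently (\<lambda>n. \<theta> \<in> exceptional n (n div l)) sequentially"
    show "hausdorff_premeasure s \<delta> E = 0"
    proof (rule hausdorff_premeasure_limsup_eq_0[OF E])
      have "(\<lambda>n. c * inverse b ^ n) \<longlonglongrightarrow> c * 0"
        using b by (intro tendsto_intros LIMSEQ_power_zero) (simp add: inverse_less_1_iff)
      then have "eventually (\<lambda>n. c * inverse b ^ n < \<delta>) sequentially"
        using \<open>0 < \<delta>\<close> by (intro order_tendstoD(2)) auto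
      then show "eventually (\<lambda>n. hausdorff_premeasure s \<delta> (exceptional n (n div l)) \<le>
          ennreal ((D * c powr s) * ((1 + t * B) / \<beta>) ^ n)) sequentially"
      proof eventually_elim
        case (elim n)
        have bn: "(b ^ n) powr s = \<beta> ^ n * \<beta> ^ n"
        proof -
          have "(b ^ n) powr s = b powr (s * n)" using b by (simp add: powr_powr mult.commute flip: powr_realpow)
          also have "\<dots> = b powr (s / 2 * n) * b powr (s / 2 * n)" by (simp flip: powr_add)
          also have "b powr (s / 2 * n) = \<beta> ^ n" unfolding \<beta>_def using b by (simp add: powr_powr flip: powr_realpow)
          finally show ?thesis .
        qed
        have "(1 / t) ^ (n div l) \<le> (\<beta> ^ l) ^ (n div l)" using l t by (intro power_mono) auto
        also have "\<dots> = \<beta> ^ (l * (n div l))" by (simp add: power_mult)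
        also have "\<dots> \<le> \<beta> ^ n" using \<beta> by (intro power_increasing) auto
        finally have tn: "(1 / t) ^ (n div l) \<le> \<beta> ^ n" .
        have "hausdorff_premeasure s \<delta> (exceptional n (n div l)) \<le>
            ennreal (card (code_pairs n (n div l)) * (c / b ^ n) powr s)"
          unfolding c_def
          by (rule hausdorff_premeasure_finite_cover[OF finite_code_pairs exceptional_subset \<open>0 < s\<close> _ _ cell_diameter])
            (use elim b c in \<open>simp_all add: c_def power_inverse divide_inverse\<close>)
        also have "\<dots> \<le> ennreal ((D * (1 + t * B) ^ n * \<beta> ^ n) * (c / b ^ n) powr s)"
          using t tn by (intro ennreal_leI mult_right_mono order_trans[OF card_code_pairs[OF t]] mult_left_mono) auto
        also have "(D * (1 + t * B) ^ n * \<beta> ^ n) * (c / b ^ n) powr s = (D * c powr s) * ((1 + t * B) / \<beta>) ^ n"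
          using b c \<beta> by (simp add: powr_divide bn power_divide)
        finally show ?case .
      qed
      show "0 \<le> D * c powr s" by simp
      show "0 \<le> (1 + t * B) / \<beta>" "(1 + t * B) / \<beta> < 1" using t \<beta> tB by auto
    qed
  qed
qed

end

section \<open>Fourier decay\<close>

text \<open>The digit 0 contributes \<open>p 0\<close> with phase 1, and a digit whose inner product
  is far from the integers contributes a term with phase bounded away from 1. These two terms lose a
  fixed amount by partial cancellation; the others are bounded by their weights.\<close>

lemma (in weighted_digits) digit_poly_gap:
  fixes a :: "nat \<Rightarrow> 'a::euclidean_space"
  assumes pos: "\<And>j. j \<le> m \<Longrightarrow> 0 < p j" and "a 0 = 0" and \<rho>: "0 < \<rho>" "\<rho> < 1/2"
  obtains \<sigma> where "0 < \<sigma>" "\<sigma> < 1" "\<And>\<xi>. \<not> near_lattice a m \<rho> \<xi> \<Longrightarrow> norm (digit_poly m a p \<xi>) \<le> \<sigma>"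
proof -
  \<comment> \<open>Law of cosines for vectors of lengths \<open>p 0\<close> and \<open>p j\<close>
    at angle \<open>2 * pi * \<rho>\<close>, plus the remaining weights.\<close>
  define l where "l j = 1 - p 0 - p j + sqrt ((p 0 + p j)\<^sup>2 - 2 * p 0 * p j * (1 - cos (2 * pi * \<rho>)))" for j
  \<comment> \<open>The element 1/2 makes \<open>\<sigma>\<close> positive and the maximum
    meaningful when \<open>m = 0\<close>.\<close>
  define \<sigma> where "\<sigma> = Max (insert (1/2) (l ` {1..m}))"
  have cos1: "cos (2 * pi * \<rho>) < 1"
    using cos_monotone_0_pi[of 0 "2 * pi * \<rho>"] \<rho> by simp
  have l1: "l j < 1" if "j \<le> m" for j
  proof -
    have "0 < 2 * p 0 * p j * (1 - cos (2 * pi * \<rho>))" using pos[of 0] pos[OF that] cos1 by simp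
    then have "sqrt ((p 0 + p j)\<^sup>2 - 2 * p 0 * p j * (1 - cos (2 * pi * \<rho>))) < sqrt ((p 0 + p j)\<^sup>2)"
      by (intro real_sqrt_less_mono) simp
    also have "\<dots> = p 0 + p j" using pos[of 0] pos[OF that] by simp
    finally show ?thesis by (simp add: l_def)
  qed
  show thesis
  proof (rule that[of \<sigma>])
    have fin: "finite (insert (1/2) (l ` {1..m}))" by simp
    have "1/2 \<le> \<sigma>" unfolding \<sigma>_def using fin by (rule Max_ge) simp
    then show "0 < \<sigma>" by simp
    show "\<sigma> < 1" unfolding \<sigma>_def using l1 by (subst Max_less_iff) auto
    fix \<xi> assume "\<not> near_lattice a m \<rho> \<xi>"
    then obtain j where j: "j \<le> m" and far: "\<rho> < \<bar>\<xi> \<bullet> a j - of_int (round (\<xi> \<bullet> a j))\<bar>"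
      by (auto simp: near_lattice_def not_le)
    have "j \<noteq> 0" using far \<rho> \<open>a 0 = 0\<close> by (intro notI) simp
    define x where "x = \<xi> \<bullet> a j"
    define y where "y = \<bar>x - of_int (round x)\<bar>"
    \<comment> \<open>The bound 1/2 keeps \<open>2 * pi * y\<close> in the range where the cosine
      decreases.\<close>
    have y: "\<rho> \<le> y" "y \<le> 1/2"
      using far of_int_round_abs_le[of x] by (auto simp: x_def y_def abs_minus_commute)
    have "cos (2 * pi * x) = cos (2 * pi * x - 2 * pi * of_int (round x))"
      by (simp add: cos_diff)
    also have "\<dots> = cos \<bar>2 * pi * (x - of_int (round x))\<bar>"
      by (simp only: cos_abs_real right_diff_distrib)
    also have "\<dots> = cos (2 * pi * y)" by (simp add: abs_mult y_def)
    also have "\<dots> \<le> cos (2 * pi * \<rho>)"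
      using y \<rho> by (intro cos_monotone_0_pi_le) auto
    finally have c: "cos (2 * pi * x) \<le> cos (2 * pi * \<rho>)" .
    have "(norm (of_real (p 0) + p j *\<^sub>R character \<xi> (a j)))\<^sup>2
        = (p 0 + p j * cos (2 * pi * x))\<^sup>2 + (p j * sin (2 * pi * x))\<^sup>2"
      by (simp add: cmod_power2 character_eq_cis x_def)
    also have "\<dots> = (p 0 + p j)\<^sup>2 - 2 * p 0 * p j * (1 - cos (2 * pi * x))"
      using sin_cos_squared_add[of "2 * pi * x"] by algebra
    also have "\<dots> \<le> (p 0 + p j)\<^sup>2 - 2 * p 0 * p j * (1 - cos (2 * pi * \<rho>))"
      using c pos[of 0] pos[OF j] by (intro diff_left_mono mult_left_mono) auto
    finally have n: "norm (of_real (p 0) + p j *\<^sub>R character \<xi> (a j)) \<le>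
        sqrt ((p 0 + p j)\<^sup>2 - 2 * p 0 * p j * (1 - cos (2 * pi * \<rho>)))"
      by (rule real_le_rsqrt)
    have split: "(\<Sum>i\<le>m. g i) = g 0 + g j + (\<Sum>i\<in>{..m} - {0, j}. g i)" for g :: "nat \<Rightarrow> 'b::ab_group_add"
      using j \<open>j \<noteq> 0\<close> sum.subset_diff[of "{0, j}" "{..m}" g] by (simp add: add.commute)
    have "digit_poly m a p \<xi> = (of_real (p 0) + p j *\<^sub>R character \<xi> (a j)) + (\<Sum>i\<in>{..m} - {0, j}. p i *\<^sub>R character \<xi> (a i))"
      unfolding digit_poly_def split using \<open>a 0 = 0\<close> by (simp add: character_def of_real_def)
    then have "norm (digit_poly m a p \<xi>) \<le> norm (of_real (p 0) + p j *\<^sub>R character \<xi> (a j))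
        + norm (\<Sum>i\<in>{..m} - {0, j}. p i *\<^sub>R character \<xi> (a i))"
      by (metis norm_triangle_ineq)
    also have "norm (\<Sum>i\<in>{..m} - {0, j}. p i *\<^sub>R character \<xi> (a i)) \<le> (\<Sum>i\<in>{..m} - {0, j}. p i)"
      using p_nonneg by (intro order_trans[OF norm_sum] sum_mono) auto
    also have "(\<Sum>i\<in>{..m} - {0, j}. p i) = 1 - p 0 - p j"
      using split[of p] p_sum by simp
    finally have "norm (digit_poly m a p \<xi>) \<le> l j" using n by (simp add: l_def)
    also have "l j \<le> \<sigma>" unfolding \<sigma>_def using fin j \<open>j \<noteq> 0\<close> by (intro Max_ge) auto
    finally show "norm (digit_poly m a p \<xi>) \<le> \<sigma>" .
  qed
qed

text \<open>For orthogonal \<open>Q\<close> the transpose of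
  \<open>inverse \<theta> *\<^sub>R Q\<close> undoes one orbit step, so iterating
  \<open>fourier_self_similar\<close> collects one factor \<open>digit_poly\<close> for each index
  from \<open>N\<close> down to 0. Far indices give at most \<open>\<sigma>\<close>, the others at
  most 1.\<close>

lemma (in weighted_digits) fourier_orbit:
  fixes Q :: "real^'n^'n"
  assumes orb: "expanding_orbits ((*v) Q) a m b b' C R" and Q: "orthogonal_matrix Q"
    and ss: "self_similar (inverse \<theta> *\<^sub>R Q) m a p \<mu>" and "1 < \<theta>"
    and \<sigma>: "0 < \<sigma>" and gap: "\<And>\<xi>. \<not> near_lattice a m (expanding_orbits.\<rho> b' C R) \<xi> \<Longrightarrow> norm (digit_poly m a p \<xi>) \<le> \<sigma>"
  shows "norm (fourier_measure \<mu> (expanding_orbits.orbit ((*v) Q) \<theta> \<eta> N)) \<le>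
    \<sigma> ^ expanding_orbits.far_count ((*v) Q) a m b' C R \<theta> \<eta> N"
proof -
  interpret expanding_orbits "(*v) Q" a m b b' C R by fact
  have "prob_space \<mu>" using ss by (simp add: self_similar_def)
  have QQ: "(Q *v x) \<bullet> (Q *v y) = x \<bullet> y" for x y
    using Q orthogonal_transformation_matrix[of "(*v) Q"] by (simp add: orthogonal_transformation_def)
  have adj: "(\<theta> *\<^sub>R (Q *v x)) v* (inverse \<theta> *\<^sub>R Q) = x" for x
  proof -
    have "((\<theta> *\<^sub>R (Q *v x)) v* (inverse \<theta> *\<^sub>R Q)) \<bullet> z = x \<bullet> z" for z
      using \<open>1 < \<theta>\<close> by (simp add: dot_lmul_matrix QQ flip: scaleR_matrix_vector_assoc)
    then show ?thesis by (metis vector_eq_rdot)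
  qed
  have step: "norm (fourier_measure \<mu> \<xi>) \<le> \<sigma> ^ (if near_lattice a m \<rho> \<xi> then 0 else 1) *
      norm (fourier_measure \<mu> (\<xi> v* (inverse \<theta> *\<^sub>R Q)))" for \<xi>
    unfolding fourier_self_similar[OF ss, of \<xi>] norm_mult
    using gap[of \<xi>] norm_digit_poly_le_1[of a \<xi>] by (intro mult_right_mono) auto
  show ?thesis
  proof (induction N)
    case 0
    have "norm (fourier_measure \<mu> (orbit \<theta> \<eta> 0)) \<le> \<sigma> ^ far_count \<theta> \<eta> 0 * 1"
      unfolding far_count_0
      by (rule order_trans[OF step mult_left_mono])
        (use \<sigma> norm_fourier_measure_le_1[OF \<open>prob_space \<mu>\<close>] in auto)
    then show ?case by simp
  next
    case (Suc N)
    have "norm (fourier_measure \<mu> (orbit \<theta> \<eta> (Suc N))) \<le>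
        \<sigma> ^ (if near_lattice a m \<rho> (orbit \<theta> \<eta> (Suc N)) then 0 else 1) * norm (fourier_measure \<mu> (orbit \<theta> \<eta> N))"
      using step[of "orbit \<theta> \<eta> (Suc N)"] by (simp only: orbit_Suc adj)
    also have "\<dots> \<le> \<sigma> ^ (if near_lattice a m \<rho> (orbit \<theta> \<eta> (Suc N)) then 0 else 1) * \<sigma> ^ far_count \<theta> \<eta> N"
      using \<sigma> Suc by (intro mult_left_mono) auto
    finally show ?case by (simp only: far_count_Suc power_add mult.commute)
  qed
qed

theorem theorem1p2:
  fixes \<O> :: "real^'n^'n" and m :: nat and a :: "nat \<Rightarrow> real^'n" and p :: "nat \<Rightarrow> real"
  assumes "orthogonal_matrix \<O>"
    and "a 0 = 0"
    and "span (a ` {..m}) = UNIV"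
    and "\<forall>j\<le>m. 0 < p j"
    and "(\<Sum>j\<le>m. p j) = 1"
  shows "\<exists>\<E> :: real set. \<E> \<subseteq> {1<..} \<and> hausdorff_dim \<E> = 0 \<and>
           (\<forall>\<theta> \<in> {1<..} - \<E>.
              self_similar_measure (inverse \<theta> *\<^sub>R \<O>) m a p \<in> power_decay)"
proof -
  interpret weighted_digits m p
    using assms(4,5) by unfold_locales (auto intro: less_imp_le)
  obtain C where C: "0 < C" "\<And>x e. (\<And>j. j \<le> m \<Longrightarrow> \<bar>x \<bullet> a j\<bar> \<le> e) \<Longrightarrow> norm x \<le> C * e"
    using norm_le_of_inner_le[OF assms(3)] by blast
  \<comment> \<open>Inserting 1 makes \<open>R\<close> positive, as \<open>expanding_orbits\<close>
    requires.\<close>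
  define R where "R = Max (insert 1 ((\<lambda>j. norm (a j)) ` {..m}))"
  have R1: "1 \<le> R" unfolding R_def by (rule Max_ge) auto
  have iso: "norm (\<O> *v x) = norm x" for x
    using assms(1) orthogonal_transformation_matrix[of "(*v) \<O>"]
    by (simp add: orthogonal_transformation_norm)
  have orbits: "expanding_orbits ((*v) \<O>) a m b b' C R" if "1 < b" "b \<le> b'" for b b'
  proof (rule expanding_orbits.intro)
    show "linear ((*v) \<O>)" by (rule matrix_vector_mul_linear)
    show "norm (a j) \<le> R" if "j \<le> m" for j
      unfolding R_def using that by (intro Max_ge) auto
  qed (use that C R1 iso in auto)
  let ?\<mu> = "\<lambda>\<theta>. self_similar_measure (inverse \<theta> *\<^sub>R \<O>) m a p"
  have ss: "self_similar (inverse \<theta> *\<^sub>R \<O>) m a p (?\<mu> \<theta>)" if "1 < \<theta>" for \<theta>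
    by (rule self_similar_measure[of _ "inverse \<theta>"])
      (use that in \<open>simp_all add: iso inverse_less_1_iff flip: scaleR_matrix_vector_assoc\<close>)
  \<comment> \<open>Taking the set of all failures leaves only its dimension to be
    determined.\<close>
  define \<E> where "\<E> = {\<theta>. 1 < \<theta> \<and> ?\<mu> \<theta> \<notin> power_decay}"
  \<comment> \<open>The constants of \<open>expanding_orbits\<close> depend on \<open>b\<close> and
    \<open>b'\<close>, so compact intervals come first.\<close>
  have piece: "hausdorff_premeasure s \<delta> (\<E> \<inter> {b..b'}) = 0"
    if "0 < s" "0 < \<delta>" "1 < b" "b \<le> b'" for s \<delta> b b'
  proof -
    interpret expanding_orbits "(*v) \<O>" a m b b' C R
      by (rule orbits) fact+
    obtain \<sigma> where \<sigma>: "0 < \<sigma>" "\<sigma> < 1"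
      and gap: "\<And>\<xi>. \<not> near_lattice a m \<rho> \<xi> \<Longrightarrow> norm (digit_poly m a p \<xi>) \<le> \<sigma>"
      using digit_poly_gap[of a \<rho>] assms(2,4) rho by blast
    obtain l where "0 < l" and l: "\<And>E. (\<And>\<theta>. \<theta> \<in> E \<Longrightarrow>
        frequently (\<lambda>n. \<theta> \<in> exceptional n (n div l)) sequentially) \<Longrightarrow> hausdorff_premeasure s \<delta> E = 0"
      using premeasure_limsup_exceptional[OF \<open>0 < s\<close>] \<open>0 < \<delta>\<close> by metis
    show ?thesis
    \<comment> \<open>Contrapositive: a \<open>\<theta>\<close> that is exceptional for only
      finitely many \<open>n\<close> would give power decay.\<close>
    proof (rule l, rule ccontr)
      fix \<theta> assume \<theta>: "\<theta> \<in> \<E> \<inter> {b..b'}"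
      assume "\<not> frequently (\<lambda>n. \<theta> \<in> exceptional n (n div l)) sequentially"
      then have ev: "eventually (\<lambda>n. \<theta> \<notin> exceptional n (n div l)) sequentially"
        by (simp add: not_frequently)
      have "1 < \<theta>" "b \<le> \<theta>" "\<theta> \<le> b'" using \<theta> by (auto simp: \<E>_def)
      have "norm (fourier_measure (?\<mu> \<theta>) (orbit \<theta> \<eta> N)) \<le> \<sigma> ^ far_count \<theta> \<eta> N" for \<eta> N
        by (rule fourier_orbit[OF expanding_orbits_axioms assms(1) ss[OF \<open>1 < \<theta>\<close>] \<open>1 < \<theta>\<close> \<sigma>(1) gap])
      then obtain \<gamma> K where "0 < \<gamma>"
        and K: "eventually (\<lambda>\<xi>. norm (fourier_measure (?\<mu> \<theta>) \<xi>) \<le> K * norm \<xi> powr (- \<gamma>)) at_infinity"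
        by (rule decay_of_not_exceptional[OF \<open>b \<le> \<theta>\<close> \<open>\<theta> \<le> b'\<close> \<sigma> \<open>0 < l\<close> ev])
      have "(\<lambda>\<xi>. norm (fourier_measure (?\<mu> \<theta>) \<xi>)) \<in> O[at_infinity](\<lambda>\<xi>. norm \<xi> powr (- \<gamma>))"
        by (rule bigoI[of _ K]) (use K in simp)
      moreover have "finite_measure (?\<mu> \<theta>)" "sets (?\<mu> \<theta>) = sets borel"
        using ss[OF \<open>1 < \<theta>\<close>] by (auto simp: self_similar_def prob_space_def)
      ultimately have "?\<mu> \<theta> \<in> power_decay"
        using \<open>0 < \<gamma>\<close> by (auto simp: power_decay_def power_decay_exp_def)
      then show False using \<theta> by (simp add: \<E>_def)
    qed
  qed
  have "hausdorff_measure s \<E> = 0" if "0 < s" for s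
  proof -
    have "hausdorff_premeasure s \<delta> \<E> = 0" if "0 < \<delta>" for \<delta>
    proof -
      \<comment> \<open>The ends tend to 1 and to infinity, so the intervals exhaust
        \<open>{1<..}\<close>; the upper end is never below the lower one, as \<open>piece\<close>
        requires.\<close>
      let ?I = "\<lambda>i::nat. {1 + 1 / (real i + 1)..real i + 2}"
      have "\<E> \<subseteq> (\<Union>i. \<E> \<inter> ?I i)"
      proof
        fix \<theta> assume \<theta>: "\<theta> \<in> \<E>"
        then have "1 < \<theta>" by (simp add: \<E>_def)
        obtain i :: nat where i: "max \<theta> (1 / (\<theta> - 1)) < real i" using reals_Archimedean2 by blast
        then have "1 / (\<theta> - 1) \<le> real i + 1" by simp
        then have "1 / (real i + 1) \<le> \<theta> - 1" using \<open>1 < \<theta>\<close> by (simp add: field_simps)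
        then have "\<theta> \<in> ?I i" using i by simp
        then show "\<theta> \<in> (\<Union>i. \<E> \<inter> ?I i)" using \<theta> by blast
      qed
      then have "hausdorff_premeasure s \<delta> \<E> \<le> (\<Sum>i. hausdorff_premeasure s \<delta> (\<E> \<inter> ?I i))"
        by (rule order_trans[OF hausdorff_premeasure_mono hausdorff_premeasure_UN_le])
      also have "\<dots> = (\<Sum>i::nat. 0)"
        using \<open>0 < s\<close> \<open>0 < \<delta>\<close> by (intro suminf_cong piece) (auto simp: divide_simps algebra_simps)
      finally show ?thesis by simp
    qed
    then show ?thesis by (simp add: hausdorff_measure_def)
  qed
  then have "hausdorff_dim \<E> = 0" by (rule hausdorff_dim_eq_0)
  then show ?thesis by (intro exI[of _ \<E>]) (auto simp: \<E>_def)
qed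

end
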